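(* Suppose the data $(x_i,y_i)$, $i=1,\dots,n$, are i.i.d. with $P(y_i=k)=\mu_k$ for $k=1,\dots,K$ and $x_i\mid\{y_i=k\}\sim\mathcal{N}(m_k,I_p)$, where $\min_k\mu_k>2c_0$ and $\|m_k\|\le C_m\sqrt p$ for all $k$, with constants $c_0>0$ and $C_m\ge2$. Run the ePTR Bayes classifier algorithm with parameters $c_0$, $R_x=4C_m\sqrt{p\log n}$, $0<\epsilon<2$, $0<\delta<n^{-3}$, and no-reply distribution $\pi_\perp$ the point mass at $0\in\mathbb{R}^{K(p+1)}$. Then there is a constant $C$ depending only on $K$, $c_0$, $C_m$ such that for all $n\ge 3$, $p\ge1$ with $n\ge\frac{4}{c_0}+\frac{8}{c_0\epsilon}\log(1/\delta)$, \[ \mathbb{E}\Big[\sum_{k=1}^K\big(|\tilde\mu_k-\mu_k|^2+\|\tilde m_k-m_k\|^2\big)\Big]\le C\Big(\frac{p}{n}+\frac{p^2\log n\,\log(1/\delta)}{\epsilon^2n^2}\Big). \]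
   Context: For $R>0$, $\Pi_R(x)=\frac{R\,x}{\max\{\|x\|,R\}}$. Efficient PTR (ePTR): fix $q$, a map $\hat\theta$ into $\mathbb{R}^q$, a level $\alpha>0$, a function $\gamma$ from datasets to $[0,\infty)$, $\epsilon>0$, $\delta\in(0,1)$, and a fixed probability distribution $\pi_\perp$ on $\mathbb{R}^q$. Let $M=1+\frac{2}{\epsilon}\log\max\{1/\delta,1/\epsilon\}$ and $p(\mathcal{X})=\frac{\exp(\frac12\epsilon(\gamma(\mathcal{X})-M))}{\exp(\frac12\epsilon(\gamma(\mathcal{X})-M))+1}$. On input $\mathcal{X}$, draw independently $I\sim\mathrm{Bernoulli}(p(\mathcal{X}))$, $\zeta\sim\mathcal{N}(0,I_q)$, $W\sim\pi_\perp$, and output $\hat\theta(\mathcal{X})+\frac{2\alpha}{\epsilon}\sqrt{2\log(1.25/\delta)}\,\zeta$ if $I=1$ and $W$ if $I=0$. ePTR Bayes classifier algorithm (data $(x_i,y_i)$, $x_i\in\mathbb{R}^p$, $y_i\in\{1,\dots,K\}$): (1) replace each $x_i$ by $\Pi_{R_x}(x_i)$; (2) with $I_k=\{j:y_j=k\}$, compute $\hat\mu_k=|I_k|/n$ and $\hat m_k=\frac{1}{|I_k|}\sum_{j\in I_k}x_j$ (with $\hat m_k=0$ if $I_k=\emptyset$); (3) apply ePTR to $\hat\theta=(\hat\mu_1,\dots,\hat\mu_K,\hat m_1,\dots,\hat m_K)\in\mathbb{R}^{K(p+1)}$ with $\gamma(\mathcal{X})=\max\{\min_k|I_k|-c_0n-1,\,0\}$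 and $\alpha=\frac{2}{n}\sqrt{\frac{2R_x^2}{c_0^2}+2}$, obtaining $(\mu'_1,\dots,\mu'_K,\tilde m_1,\dots,\tilde m_K)$; (4) set $\tilde\mu_k=\frac{\max\{\mu'_k,c_0\}}{\sum_{j=1}^K\max\{\mu'_j,c_0\}}$. The expectation is over the data and the algorithm's randomness. *)

theory Defs
  imports "HOL-Probability.Probability"
begin

text \<open>Vectors in R^p are represented as functions nat => real; only the
coordinates 0..p-1 matter.\<close>

definition vnorm :: "nat \<Rightarrow> (nat \<Rightarrow> real) \<Rightarrow> real" where
  "vnorm p x = sqrt (\<Sum>j<p. (x j)^2)"

definition proj_ball :: "nat \<Rightarrow> real \<Rightarrow> (nat \<Rightarrow> real) \<Rightarrow> (nat \<Rightarrow> real)" where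
  "proj_ball p R x = (\<lambda>j. R * x j / max (vnorm p x) R)"

definition sample_dist ::
  "nat \<Rightarrow> nat \<Rightarrow> (nat \<Rightarrow> real) \<Rightarrow> (nat \<Rightarrow> nat \<Rightarrow> real) \<Rightarrow> (nat \<times> (nat \<Rightarrow> real)) measure" where
  "sample_dist K p mu m =
     density (pair_measure (count_space UNIV) (PiM {..<p} (\<lambda>_. lborel)))
       (\<lambda>(k, x). ennreal (if k \<in> {1..K} then mu k * (\<Prod>j<p. normal_density (m k j) 1 (x j)) else 0))"

definition data_dist ::
  "nat \<Rightarrow> nat \<Rightarrow> nat \<Rightarrow> (nat \<Rightarrow> real) \<Rightarrow> (nat \<Rightarrow> nat \<Rightarrow> real) \<Rightarrow> (nat \<Rightarrow> nat \<times> (nat \<Rightarrow> real)) measure" where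
  "data_dist n K p mu m = PiM {..<n} (\<lambda>_. sample_dist K p mu m)"

definition std_gauss :: "nat \<Rightarrow> (nat \<Rightarrow> real) measure" where
  "std_gauss q = PiM {..<q} (\<lambda>_. density lborel std_normal_density)"

definition class_idx :: "nat \<Rightarrow> (nat \<Rightarrow> nat \<times> (nat \<Rightarrow> real)) \<Rightarrow> nat \<Rightarrow> nat set" where
  "class_idx n z k = {j. j < n \<and> fst (z j) = k}"

definition mu_hat :: "nat \<Rightarrow> (nat \<Rightarrow> nat \<times> (nat \<Rightarrow> real)) \<Rightarrow> nat \<Rightarrow> real" where
  "mu_hat n z k = real (card (class_idx n z k)) / real n"

definition m_hat :: "nat \<Rightarrow> nat \<Rightarrow> real \<Rightarrow> (nat \<Rightarrow> nat \<times> (nat \<Rightarrow> real)) \<Rightarrow> nat \<Rightarrow> (nat \<Rightarrow> real)" where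
  "m_hat n p Rx z k = (if class_idx n z k = {} then (\<lambda>_. 0)
     else (\<lambda>j. (\<Sum>i\<in>class_idx n z k. proj_ball p Rx (snd (z i)) j) / real (card (class_idx n z k))))"

text \<open>Encoding of (mu_1..mu_K, m_1..m_K) as a vector in R^(K(p+1)):
coordinate k-1 is mu_k, coordinate K + (k-1)p + j is the j-th coordinate of m_k.\<close>
definition theta_hat :: "nat \<Rightarrow> nat \<Rightarrow> nat \<Rightarrow> real \<Rightarrow> (nat \<Rightarrow> nat \<times> (nat \<Rightarrow> real)) \<Rightarrow> (nat \<Rightarrow> real)" where
  "theta_hat n K p Rx z = (\<lambda>i. if i < K then mu_hat n z (i + 1)
      else if i < K * (p + 1) then m_hat n p Rx z ((i - K) div p + 1) ((i - K) mod p)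
      else 0)"

definition dec_mu :: "nat \<Rightarrow> (nat \<Rightarrow> real) \<Rightarrow> nat \<Rightarrow> real" where
  "dec_mu K v k = v (k - 1)"

definition dec_m :: "nat \<Rightarrow> nat \<Rightarrow> (nat \<Rightarrow> real) \<Rightarrow> nat \<Rightarrow> (nat \<Rightarrow> real)" where
  "dec_m K p v k = (\<lambda>j. v (K + (k - 1) * p + j))"

definition mu_tilde :: "nat \<Rightarrow> real \<Rightarrow> (nat \<Rightarrow> real) \<Rightarrow> nat \<Rightarrow> real" where
  "mu_tilde K c0 v k = max (dec_mu K v k) c0 / (\<Sum>j\<in>{1..K}. max (dec_mu K v j) c0)"

definition gamma_fn :: "nat \<Rightarrow> nat \<Rightarrow> real \<Rightarrow> (nat \<Rightarrow> nat \<times> (nat \<Rightarrow> real)) \<Rightarrow> real" where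
  "gamma_fn n K c0 z = max (real (Min ((\<lambda>k. card (class_idx n z k)) ` {1..K})) - c0 * real n - 1) 0"

definition ePTR_M :: "real \<Rightarrow> real \<Rightarrow> real" where
  "ePTR_M \<epsilon> \<delta> = 1 + (2 / \<epsilon>) * ln (max (1 / \<delta>) (1 / \<epsilon>))"

definition ePTR_prob :: "real \<Rightarrow> real \<Rightarrow> real \<Rightarrow> real" where
  "ePTR_prob \<epsilon> \<delta> g = exp (\<epsilon> / 2 * (g - ePTR_M \<epsilon> \<delta>)) / (exp (\<epsilon> / 2 * (g - ePTR_M \<epsilon> \<delta>)) + 1)"

definition alpha_fn :: "nat \<Rightarrow> real \<Rightarrow> real \<Rightarrow> real" where
  "alpha_fn n Rx c0 = 2 / real n * sqrt (2 * Rx^2 / c0^2 + 2)"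

definition noise_scale :: "real \<Rightarrow> real \<Rightarrow> real \<Rightarrow> real" where
  "noise_scale \<alpha> \<epsilon> \<delta> = 2 * \<alpha> / \<epsilon> * sqrt (2 * ln (1.25 / \<delta>))"

definition est_loss ::
  "nat \<Rightarrow> nat \<Rightarrow> real \<Rightarrow> (nat \<Rightarrow> real) \<Rightarrow> (nat \<Rightarrow> nat \<Rightarrow> real) \<Rightarrow> (nat \<Rightarrow> real) \<Rightarrow> real" where
  "est_loss K p c0 mu m v = (\<Sum>k\<in>{1..K}. (mu_tilde K c0 v k - mu k)^2
       + (vnorm p (\<lambda>j. dec_m K p v k j - m k j))^2)"

text \<open>Expected loss of the ePTR Bayes classifier algorithm, with pi_perp the
point mass at 0: expectation over the data and over I ~ Bernoulli(p(X)),
zeta ~ N(0, I_q) (W = 0 almost surely).\<close>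
definition expected_loss ::
  "nat \<Rightarrow> nat \<Rightarrow> nat \<Rightarrow> real \<Rightarrow> real \<Rightarrow> real \<Rightarrow> real \<Rightarrow> (nat \<Rightarrow> real) \<Rightarrow> (nat \<Rightarrow> nat \<Rightarrow> real) \<Rightarrow> ennreal" where
  "expected_loss n K p c0 Rx \<epsilon> \<delta> mu m =
     (\<integral>\<^sup>+ z. (let pz = ePTR_prob \<epsilon> \<delta> (gamma_fn n K c0 z);
                  th = theta_hat n K p Rx z;
                  s = noise_scale (alpha_fn n Rx c0) \<epsilon> \<delta>
              in ennreal pz * (\<integral>\<^sup>+ \<zeta>. ennreal (est_loss K p c0 mu m (\<lambda>i. th i + s * \<zeta> i))
                                   \<partial>std_gauss (K * (p + 1)))
                 + ennreal (1 - pz) * ennreal (est_loss K p c0 mu m (\<lambda>_. 0)))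
       \<partial>data_dist n K p mu m)"

end

theory Submission
  imports Defs
begin

text \<open>The integrand of the risk is bounded, pointwise in the data, by quantities whose means are
explicit. If some class has at most \<open>c0 n + 1\<close> points, then \<open>\<gamma> = 0\<close> and the reply
probability is at most \<open>\<delta> < n\<^sup>-\<^sup>3\<close>, so the crude bound by the clipping radius
suffices. Otherwise the error of a class mean splits into an average of centred Gaussians and a
clipping error. By Jensen's inequality the latter is at most a constant over \<open>n\<close> times the sum
over \<open>j\<close> of the exponentials of \<open>(x j - m k j)\<^sup>2 / 4\<close>, each with mean \<open>\<surd>2\<close>, so no
tail bound for the norm of a Gaussian vector is needed. If no class frequency is off by more than
\<open>c0 / 2\<close>, the no-reply probability is at most \<open>1 / n\<close>; otherwise it is absorbed, as in
Chebyshev's inequality, by the squared errors of the frequencies. The algorithm need not be shown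
measurable, because \<open>nn_integral\<close> is monotone for arbitrary functions.\<close>

subsection \<open>Moments of the sample\<close>

lemma nn_integral_PiM_component:
  assumes "\<And>i. i \<in> I \<Longrightarrow> prob_space (M i)" "i \<in> I" "f \<in> borel_measurable (M i)"
  shows "(\<integral>\<^sup>+z. f (z i) \<partial>PiM I M) = (\<integral>\<^sup>+x. f x \<partial>M i)"
proof -
  have "(\<integral>\<^sup>+x. f x \<partial>M i) = (\<integral>\<^sup>+x. f x \<partial>distr (PiM I M) (M i) (\<lambda>z. z i))"
    using distr_PiM_component[of I M i] assms by simp
  also have "\<dots> = (\<integral>\<^sup>+z. f (z i) \<partial>PiM I M)"
    using assms by (intro nn_integral_distr) auto
  finally show ?thesis by simp
qed

text \<open>Variance of an i.i.d. sum: after expanding the square, every cross term contains a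
  centred factor and vanishes by independence, so only the \<open>n\<close> diagonal terms
  survive.\<close>

lemma nn_integral_PiM_square_sum_centered:
  fixes X :: "'a \<Rightarrow> real" and n :: nat
  assumes "prob_space N"
    and X: "integrable N X" and X2: "integrable N (\<lambda>x. (X x)\<^sup>2)" and X0: "(\<integral>x. X x \<partial>N) = 0"
  shows "(\<integral>\<^sup>+z. ennreal ((\<Sum>i<n. X (z i))\<^sup>2) \<partial>PiM {..<n} (\<lambda>_. N)) = ennreal (n * (\<integral>x. (X x)\<^sup>2 \<partial>N))"
proof -
  interpret N: prob_space N by fact
  interpret P: product_sigma_finite "\<lambda>_::nat. N" by standard
  \<comment> \<open>\<open>X (z i) * X (z l)\<close> is written as a product over all coordinates
    \<open>a\<close>, so that one product formula covers both cases: for \<open>i = l\<close> the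
    factor at \<open>i\<close> is the square of \<open>X\<close>, for \<open>i \<noteq> l\<close>
    there are two separate factors.\<close>
  define F where "F i l a = (\<lambda>y. (if a = i then X y else 1) * (if a = l then X y else 1))" for i l a :: nat
  have Fint: "integrable N (F i l a)" for i l a
    using X X2 by (cases "a = i"; cases "a = l") (auto simp: F_def power2_eq_square)
  have prodF: "(\<Prod>a<n. F i l a (z a)) = X (z i) * X (z l)" if "i < n" "l < n" for i l and z :: "nat \<Rightarrow> 'a"
    using that by (simp add: F_def prod.distrib)
  have int: "integrable (PiM {..<n} (\<lambda>_. N)) (\<lambda>z. X (z i) * X (z l))" if "i < n" "l < n" for i l
    using P.product_integrable_prod[of "{..<n}" "F i l"] that Fint by (simp add: prodF)
  have cov: "(\<integral>z. X (z i) * X (z l) \<partial>PiM {..<n} (\<lambda>_. N)) = (if i = l then \<integral>x. (X x)\<^sup>2 \<partial>N else 0)"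
    if "i < n" "l < n" for i l
  proof -
    have "(\<integral>z. X (z i) * X (z l) \<partial>PiM {..<n} (\<lambda>_. N)) = (\<Prod>a<n. \<integral>y. F i l a y \<partial>N)"
      using P.product_integral_prod[of "{..<n}" "F i l"] that Fint by (simp add: prodF)
    also have "\<dots> = (if i = l then \<integral>x. (X x)\<^sup>2 \<partial>N else 0)"
    proof (cases "i = l")
      case True
      have "(\<integral>y. F i l a y \<partial>N) = (if a = i then \<integral>x. (X x)\<^sup>2 \<partial>N else 1)" for a
        using True by (simp add: F_def power2_eq_square N.prob_space)
      then show ?thesis using True that by simp
    next
      case False
      then have "(\<integral>y. F i l i y \<partial>N) = 0" using X0 by (simp add: F_def)
      then show ?thesis using False that by (auto intro!: bexI[of _ i])
    qed
    finally show ?thesis .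
  qed
  have sq: "integrable (PiM {..<n} (\<lambda>_. N)) (\<lambda>z. (\<Sum>i<n. X (z i))\<^sup>2)"
    unfolding power2_eq_square sum_product using int by (intro Bochner_Integration.integrable_sum) auto
  have "(\<integral>\<^sup>+z. ennreal ((\<Sum>i<n. X (z i))\<^sup>2) \<partial>PiM {..<n} (\<lambda>_. N))
    = ennreal (\<integral>z. (\<Sum>i<n. X (z i))\<^sup>2 \<partial>PiM {..<n} (\<lambda>_. N))"
    using sq by (intro nn_integral_eq_integral) auto
  also have "(\<integral>z. (\<Sum>i<n. X (z i))\<^sup>2 \<partial>PiM {..<n} (\<lambda>_. N))
    = (\<integral>z. (\<Sum>i<n. \<Sum>l<n. X (z i) * X (z l)) \<partial>PiM {..<n} (\<lambda>_. N))"
    by (simp add: power2_eq_square sum_product)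
  also have "\<dots> = (\<Sum>i<n. \<integral>z. (\<Sum>l<n. X (z i) * X (z l)) \<partial>PiM {..<n} (\<lambda>_. N))"
    using int by (intro Bochner_Integration.integral_sum Bochner_Integration.integrable_sum) auto
  also have "\<dots> = (\<Sum>i<n. \<Sum>l<n. \<integral>z. X (z i) * X (z l) \<partial>PiM {..<n} (\<lambda>_. N))"
    using int by (intro sum.cong refl Bochner_Integration.integral_sum) auto
  also have "\<dots> = (\<Sum>i<n. \<Sum>l<n. if i = l then \<integral>x. (X x)\<^sup>2 \<partial>N else 0)"
    by (intro sum.cong refl cov) auto
  also have "\<dots> = n * (\<integral>x. (X x)\<^sup>2 \<partial>N)" by simp
  finally show ?thesis .
qed

text \<open>The weight lowers the Gaussian exponent from 1/2 to 1/4, which is the shape of a normal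
  density of variance 2; the ratio of the two normalising constants is
  \<open>sqrt 2\<close>.\<close>

lemma exp_square_moment_normal:
  "(\<integral>\<^sup>+y. ennreal (exp ((y - a)\<^sup>2 / 4)) * ennreal (normal_density a 1 y) \<partial>lborel) = ennreal (sqrt 2)"
proof -
  have "(\<integral>\<^sup>+y. ennreal (exp ((y - a)\<^sup>2 / 4)) * ennreal (normal_density a 1 y) \<partial>lborel)
    = (\<integral>\<^sup>+y. ennreal (sqrt 2) * ennreal (normal_density a (sqrt 2) y) \<partial>lborel)"
  proof (rule nn_integral_cong)
    fix y
    have "exp ((y - a)\<^sup>2 / 4) * exp (- (y - a)\<^sup>2 / 2) = exp (- (y - a)\<^sup>2 / 4)"
      by (simp add: field_simps flip: exp_add)
    then have "exp ((y - a)\<^sup>2 / 4) * normal_density a 1 y = sqrt 2 * normal_density a (sqrt 2) y"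
      by (simp add: normal_density_def real_sqrt_mult field_simps)
    then show "ennreal (exp ((y - a)\<^sup>2 / 4)) * ennreal (normal_density a 1 y)
      = ennreal (sqrt 2) * ennreal (normal_density a (sqrt 2) y)"
      by (metis ennreal_mult' exp_ge_zero real_sqrt_ge_zero zero_le_numeral)
  qed
  also have "\<dots> = ennreal (sqrt 2) * ennreal (\<integral>y. normal_density a (sqrt 2) y \<partial>lborel)"
    by (subst nn_integral_cmult) (auto simp: nn_integral_eq_integral)
  finally show ?thesis by simp
qed

lemma nn_integral_std_gauss_square:
  assumes "i < q"
  shows "(\<integral>\<^sup>+\<zeta>. ennreal ((\<zeta> i)\<^sup>2) \<partial>std_gauss q) = 1"
proof -
  have "(\<integral>\<^sup>+\<zeta>. ennreal ((\<zeta> i)\<^sup>2) \<partial>std_gauss q) = (\<integral>\<^sup>+y. ennreal (y\<^sup>2) \<partial>density lborel std_normal_density)"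
    unfolding std_gauss_def using assms
    by (intro nn_integral_PiM_component[where f = "\<lambda>y. ennreal (y\<^sup>2)"] prob_space_normal_density) auto
  also have "\<dots> = (\<integral>\<^sup>+y. ennreal (std_normal_density y * y\<^sup>2) \<partial>lborel)"
    by (subst nn_integral_density) (auto simp: ennreal_mult')
  also have "\<dots> = ennreal (\<integral>y. std_normal_density y * y\<^sup>2 \<partial>lborel)"
    using integrable_std_normal_moment[of 2] by (intro nn_integral_eq_integral) auto
  also have "(\<integral>y. std_normal_density y * y\<^sup>2 \<partial>lborel) = 1"
    using integral_std_normal_moment_even[of 1] by (simp add: fact_numeral)
  finally show ?thesis by simp
qed

section \<open>Integrals under the law of one labelled observation\<close>

text \<open>Every later moment involves the label and a single coordinate. The density is a product
  over coordinates, so all Gaussian factors other than the \<open>j\<close>-th integrate to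
  1.\<close>

lemma nn_integral_sample_dist_coord:
  fixes h :: "nat \<Rightarrow> real \<Rightarrow> ennreal"
  assumes mu: "\<And>k. k \<in> {1..K} \<Longrightarrow> 0 \<le> mu k" and j: "j < p"
    and h[measurable]: "\<And>k. h k \<in> borel_measurable borel"
  shows "(\<integral>\<^sup>+z. h (fst z) (snd z j) \<partial>sample_dist K p mu m)
    = (\<Sum>k=1..K. ennreal (mu k) * (\<integral>\<^sup>+y. h k y * ennreal (normal_density (m k j) 1 y) \<partial>lborel))"
proof -
  let ?L = "PiM {..<p} (\<lambda>_. lborel :: real measure)"
  let ?d = "\<lambda>(k, x). ennreal (if k \<in> {1..K} then mu k * (\<Prod>j<p. normal_density (m k j) 1 (x j)) else 0)"
  interpret L: product_sigma_finite "\<lambda>_::nat. lborel :: real measure" by standard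
  interpret fL: finite_product_sigma_finite "\<lambda>_::nat. lborel :: real measure" "{..<p}" by standard simp
  \<comment> \<open>Labels form a countable discrete space, so joint measurability reduces to
    measurability in \<open>x\<close> for each fixed label.\<close>
  have d[measurable]: "?d \<in> borel_measurable (count_space UNIV \<Otimes>\<^sub>M ?L)"
    by (intro measurable_pair_measure_countable1) auto
  have h2[measurable]: "(\<lambda>z. h (fst z) (snd z j)) \<in> borel_measurable (count_space UNIV \<Otimes>\<^sub>M ?L)"
    using j by (intro measurable_pair_measure_countable1) auto
  have "(\<integral>\<^sup>+z. h (fst z) (snd z j) \<partial>sample_dist K p mu m)
    = (\<integral>\<^sup>+z. ?d z * h (fst z) (snd z j) \<partial>(count_space UNIV \<Otimes>\<^sub>M ?L))"
    unfolding sample_dist_def by (subst nn_integral_density) auto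
  also have "\<dots> = (\<integral>\<^sup>+k. (\<integral>\<^sup>+x. ?d (k, x) * h k (x j) \<partial>?L) \<partial>count_space UNIV)"
    by (subst fL.nn_integral_fst[symmetric]) auto
  also have "\<dots> = (\<Sum>k=1..K. \<integral>\<^sup>+x. ?d (k, x) * h k (x j) \<partial>?L)"
    by (intro nn_integral_count_space') auto
  also have "\<dots> = (\<Sum>k=1..K. ennreal (mu k) * (\<integral>\<^sup>+y. h k y * ennreal (normal_density (m k j) 1 y) \<partial>lborel))"
  proof (rule sum.cong[OF refl])
    fix k assume k: "k \<in> {1..K}"
    \<comment> \<open>\<open>h\<close> is attached to the \<open>j\<close>-th factor, which turns
      the whole integrand into a product over coordinates.\<close>
    let ?f = "\<lambda>i y. (if i = j then h k y else 1) * ennreal (normal_density (m k i) 1 y)"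
    have "(\<integral>\<^sup>+x. ?d (k, x) * h k (x j) \<partial>?L) = (\<integral>\<^sup>+x. ennreal (mu k) * (\<Prod>i<p. ?f i (x i)) \<partial>?L)"
      using k mu[OF k] j
      by (intro nn_integral_cong)
        (simp add: prod.distrib prod.delta ennreal_mult prod_nonneg prod_ennreal mult_ac)
    also have "\<dots> = ennreal (mu k) * (\<integral>\<^sup>+x. (\<Prod>i<p. ?f i (x i)) \<partial>?L)"
      by (intro nn_integral_cmult) measurable
    also have "(\<integral>\<^sup>+x. (\<Prod>i<p. ?f i (x i)) \<partial>?L) = (\<Prod>i<p. \<integral>\<^sup>+y. ?f i y \<partial>lborel)"
      by (intro L.product_nn_integral_prod) auto
    also have "\<dots> = (\<Prod>i<p. if i = j then \<integral>\<^sup>+y. h k y * ennreal (normal_density (m k j) 1 y) \<partial>lborel else 1)"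
      by (intro prod.cong) (auto simp: nn_integral_eq_integral)
    finally show "(\<integral>\<^sup>+x. ?d (k, x) * h k (x j) \<partial>?L)
      = ennreal (mu k) * (\<integral>\<^sup>+y. h k y * ennreal (normal_density (m k j) 1 y) \<partial>lborel)"
      using j by (simp add: prod.delta)
  qed
  finally show ?thesis .
qed

lemma measurable_sample_dist_coord:
  assumes "j < p" "\<And>k. h k \<in> borel_measurable borel"
  shows "(\<lambda>z. h (fst z) (snd z j)) \<in> borel_measurable (sample_dist K p mu m)"
  unfolding sample_dist_def using assms
  by (auto intro!: measurable_pair_measure_countable1)


text \<open>The total mass is the coordinate formula for the constant function 1;
  \<open>p \<ge> 1\<close> supplies coordinate 0.\<close>

lemma prob_space_sample_dist:
  assumes mu: "\<And>k. k \<in> {1..K} \<Longrightarrow> 0 \<le> mu k" "(\<Sum>k=1..K. mu k) = 1" and p: "p \<ge> 1"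
  shows "prob_space (sample_dist K p mu m)"
proof
  have "emeasure (sample_dist K p mu m) (space (sample_dist K p mu m))
    = (\<integral>\<^sup>+z. (\<lambda>_ _. 1) (fst z) (snd z (0::nat)) \<partial>sample_dist K p mu m)"
    by simp
  also have "\<dots> = (\<Sum>k=1..K. ennreal (mu k))"
    using p by (subst nn_integral_sample_dist_coord[where j = 0 and p = p]) (auto simp: mu nn_integral_eq_integral)
  also have "\<dots> = 1" using mu by (subst sum_ennreal) auto
  finally show "emeasure (sample_dist K p mu m) (space (sample_dist K p mu m)) = 1" .
qed

text \<open>\<open>h\<close> may be negative: \<open>ennreal\<close> then cuts it off at 0, so
  applying the lemma to a function and to its negative yields the integrals of its positive and
  negative parts.\<close>

lemma nn_integral_sample_dist_class:
  assumes mu: "\<And>k. k \<in> {1..K} \<Longrightarrow> 0 \<le> mu k" and j: "j < p" and k: "k \<in> {1..K}"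
    and h[measurable]: "h \<in> borel_measurable borel"
  shows "(\<integral>\<^sup>+z. ennreal (of_bool (fst z = k) * h (snd z j)) \<partial>sample_dist K p mu m)
    = ennreal (mu k) * (\<integral>\<^sup>+y. ennreal (h y) * ennreal (normal_density (m k j) 1 y) \<partial>lborel)"
proof -
  have "(\<integral>\<^sup>+z. ennreal (of_bool (fst z = k) * h (snd z j)) \<partial>sample_dist K p mu m)
    = (\<Sum>i=1..K. ennreal (mu i) * (\<integral>\<^sup>+y. ennreal (of_bool (i = k) * h y) * ennreal (normal_density (m i j) 1 y) \<partial>lborel))"
    using mu j by (intro nn_integral_sample_dist_coord[where h = "\<lambda>i y. ennreal (of_bool (i = k) * h y)"]) auto
  also have "\<dots> = (\<Sum>i=1..K. if i = k then ennreal (mu k) * (\<integral>\<^sup>+y. ennreal (h y) * ennreal (normal_density (m k j) 1 y) \<partial>lborel) else 0)"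
    by (intro sum.cong) auto
  finally show ?thesis using k by simp
qed

lemma measurable_sample_dist_class[measurable]:
  assumes "j < p" and h: "h \<in> borel_measurable borel"
  shows "(\<lambda>z. of_bool (fst z = k) * h (snd z j) :: real) \<in> borel_measurable (sample_dist K p mu m)"
  using assms by (intro measurable_sample_dist_coord[where h = "\<lambda>i y. of_bool (i = k) * h y"]) auto

section \<open>Moments of class counts and class sums\<close>

text \<open>The centred indicator is bounded by 1 in absolute value, hence its variance is at most
  1.\<close>

lemma nn_integral_class_freq:
  assumes mu: "\<And>k. k \<in> {1..K} \<Longrightarrow> 0 \<le> mu k" "(\<Sum>k=1..K. mu k) = 1" and p: "p \<ge> 1" and k: "k \<in> {1..K}"
  shows "(\<integral>\<^sup>+z. ennreal ((\<Sum>i<n. of_bool (fst (z i) = k) - mu k)\<^sup>2) \<partial>data_dist n K p mu m) \<le> ennreal n"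
proof -
  let ?S = "sample_dist K p mu m"
  interpret prob_space ?S using mu p by (rule prob_space_sample_dist)
  define X where "X z = of_bool (fst z = k) - mu k" for z :: "nat \<times> (nat \<Rightarrow> real)"
  have [measurable]: "(\<lambda>z. of_bool (fst z = k) :: real) \<in> borel_measurable ?S"
    using measurable_sample_dist_class[of 0 p "\<lambda>_. 1"] p by simp
  have "mu k \<le> 1" using mu k member_le_sum[of k "{1..K}" mu] by auto
  then have b: "\<bar>X z\<bar> \<le> 1" for z using mu k by (auto simp: X_def)
  have b2: "(X z)\<^sup>2 \<le> 1" for z using b[of z] by (simp add: abs_square_le_1)
  have [measurable]: "X \<in> borel_measurable ?S" unfolding X_def by measurable
  have i1: "integrable ?S X" by (rule integrable_const_bound[of _ 1]) (auto simp: b)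
  have i2: "integrable ?S (\<lambda>z. (X z)\<^sup>2)" by (rule integrable_const_bound[of _ 1]) (auto simp: b2)
  have iB: "integrable ?S (\<lambda>z. of_bool (fst z = k) :: real)"
    by (rule integrable_const_bound[of _ 1]) auto
  have "(\<integral>\<^sup>+z. ennreal (of_bool (fst z = k)) \<partial>?S) = ennreal (mu k)"
    using nn_integral_sample_dist_class[of K mu 0 p k "\<lambda>_. 1" m] mu p k by (simp add: nn_integral_eq_integral)
  then have "(\<integral>z. of_bool (fst z = k) \<partial>?S) = mu k"
    using mu k by (subst integral_eq_nn_integral) auto
  then have "(\<integral>z. X z \<partial>?S) = 0" unfolding X_def using iB by (simp add: prob_space)
  from nn_integral_PiM_square_sum_centered[OF prob_space_axioms i1 i2 this, of n]
  have "(\<integral>\<^sup>+z. ennreal ((\<Sum>i<n. of_bool (fst (z i) = k) - mu k)\<^sup>2) \<partial>data_dist n K p mu m)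
    = ennreal (n * (\<integral>z. (X z)\<^sup>2 \<partial>?S))"
    unfolding data_dist_def by (simp add: X_def)
  also have "(\<integral>z. (X z)\<^sup>2 \<partial>?S) \<le> (\<integral>z. 1 \<partial>?S)"
    using i2 b2 by (intro integral_mono) auto
  then have "ennreal (n * (\<integral>z. (X z)\<^sup>2 \<partial>?S)) \<le> ennreal n"
    by (intro ennreal_leI) (simp add: prob_space mult_left_le)
  finally show ?thesis .
qed

text \<open>Summing over all \<open>i < n\<close> with an indicator, instead of over the random
  index set of class \<open>k\<close>, gives a genuine i.i.d. sum. Its summands are centred with
  second moment \<open>mu k \<le> 1\<close>.\<close>

lemma nn_integral_class_sum:
  assumes mu: "\<And>k. k \<in> {1..K} \<Longrightarrow> 0 \<le> mu k" "(\<Sum>k=1..K. mu k) = 1" and j: "j < p" and k: "k \<in> {1..K}"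
  shows "(\<integral>\<^sup>+z. ennreal ((\<Sum>i<n. of_bool (fst (z i) = k) * (snd (z i) j - m k j))\<^sup>2) \<partial>data_dist n K p mu m) \<le> ennreal n"
proof -
  let ?S = "sample_dist K p mu m" and ?N = "normal_density (m k j) 1"
  have p: "p \<ge> 1" using j by simp
  interpret prob_space ?S using mu p by (rule prob_space_sample_dist)
  define X where "X z = of_bool (fst z = k) * (snd z j - m k j)" for z :: "nat \<times> (nat \<Rightarrow> real)"
  have X[measurable]: "X \<in> borel_measurable ?S"
    unfolding X_def using measurable_sample_dist_class[OF j, of "\<lambda>y. y - m k j"] by simp
  have "mu k \<le> 1" using mu k member_le_sum[of k "{1..K}" mu] by auto
  have "(\<integral>\<^sup>+z. ennreal ((X z)\<^sup>2) \<partial>?S) = (\<integral>\<^sup>+z. ennreal (of_bool (fst z = k) * (snd z j - m k j)\<^sup>2) \<partial>?S)"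
    by (intro nn_integral_cong) (auto simp: X_def)
  also have "\<dots> = ennreal (mu k) * (\<integral>\<^sup>+y. ennreal ((y - m k j)\<^sup>2) * ennreal (?N y) \<partial>lborel)"
    using nn_integral_sample_dist_class[of K mu j p k "\<lambda>y. (y - m k j)\<^sup>2" m] mu j k by simp
  also have "(\<integral>\<^sup>+y. ennreal ((y - m k j)\<^sup>2) * ennreal (?N y) \<partial>lborel)
    = ennreal (\<integral>y. ?N y * (y - m k j)\<^sup>2 \<partial>lborel)"
    using integrable_normal_moment[of 1 "m k j" 2]
    by (subst nn_integral_eq_integral[symmetric]) (auto simp: ennreal_mult' mult.commute)
  also have "(\<integral>y. ?N y * (y - m k j)\<^sup>2 \<partial>lborel) = 1"
    using integral_normal_moment_even[of 1 "m k j" 1] by (simp add: fact_numeral)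
  finally have n2: "(\<integral>\<^sup>+z. ennreal ((X z)\<^sup>2) \<partial>?S) = ennreal (mu k)" by simp
  have i2: "integrable ?S (\<lambda>z. (X z)\<^sup>2)"
    using n2 by (intro integrableI_bounded) auto
  have v: "(\<integral>z. (X z)\<^sup>2 \<partial>?S) = mu k"
    using n2 mu k by (subst integral_eq_nn_integral) auto
  have i1: "integrable ?S X"
  proof (rule Bochner_Integration.integrable_bound)
    show "integrable ?S (\<lambda>z. 1 + (X z)\<^sup>2)" using i2 by simp
    have "\<bar>x\<bar> \<le> 1 + x\<^sup>2" for x :: real
    proof -
      have "0 \<le> (\<bar>x\<bar> - 1)\<^sup>2" by simp
      then have "2 * \<bar>x\<bar> \<le> 1 + x\<^sup>2" unfolding power2_diff by simp
      then show ?thesis by simp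
    qed
    then show "AE z in ?S. norm (X z) \<le> norm (1 + (X z)\<^sup>2)" by simp
  qed simp
  \<comment> \<open>The mean vanishes because the positive and negative parts of \<open>X\<close>
    have equal integrals: the reflection of \<open>y\<close> to \<open>2 * m k j - y\<close>
    preserves the normal density and exchanges them.\<close>
  have "(\<integral>\<^sup>+z. ennreal (X z) \<partial>?S) = ennreal (mu k) * (\<integral>\<^sup>+y. ennreal (y - m k j) * ennreal (?N y) \<partial>lborel)"
    unfolding X_def using nn_integral_sample_dist_class[of K mu j p k "\<lambda>y. y - m k j" m] mu j k by simp
  also have "(\<integral>\<^sup>+y. ennreal (y - m k j) * ennreal (?N y) \<partial>lborel)
    = (\<integral>\<^sup>+y. ennreal (m k j - y) * ennreal (?N y) \<partial>lborel)"
    by (subst nn_integral_real_affine[where c = "-1" and t = "2 * m k j"])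
      (auto simp: normal_density_def power2_commute)
  also have "ennreal (mu k) * \<dots> = (\<integral>\<^sup>+z. ennreal (- X z) \<partial>?S)"
    unfolding X_def using nn_integral_sample_dist_class[of K mu j p k "\<lambda>y. m k j - y" m] mu j k
    by (simp flip: mult_minus_right)
  finally have "(\<integral>z. X z \<partial>?S) = 0"
    by (simp add: real_lebesgue_integral_def[OF i1])
  from nn_integral_PiM_square_sum_centered[OF prob_space_axioms i1 i2 this, of n]
  have "(\<integral>\<^sup>+z. ennreal ((\<Sum>i<n. of_bool (fst (z i) = k) * (snd (z i) j - m k j))\<^sup>2) \<partial>data_dist n K p mu m)
    = ennreal (n * mu k)"
    unfolding data_dist_def by (simp add: X_def v[unfolded X_def])
  then show ?thesis using \<open>mu k \<le> 1\<close> by (simp add: ennreal_leI mult_left_le)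
qed

lemma nn_integral_class_exp:
  assumes mu: "\<And>k. k \<in> {1..K} \<Longrightarrow> 0 \<le> mu k" "(\<Sum>k=1..K. mu k) = 1" and j: "j < p" and k: "k \<in> {1..K}"
    and i: "i < n"
  shows "(\<integral>\<^sup>+z. ennreal (of_bool (fst (z i) = k) * exp ((snd (z i) j - m k j)\<^sup>2 / 4)) \<partial>data_dist n K p mu m) \<le> ennreal 2"
proof -
  let ?S = "sample_dist K p mu m"
  have p: "p \<ge> 1" using j by simp
  interpret prob_space ?S using mu p by (rule prob_space_sample_dist)
  have "mu k \<le> 1" using mu k member_le_sum[of k "{1..K}" mu] by auto
  have "(\<integral>\<^sup>+z. ennreal (of_bool (fst (z i) = k) * exp ((snd (z i) j - m k j)\<^sup>2 / 4)) \<partial>data_dist n K p mu m)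
    = (\<integral>\<^sup>+z. ennreal (of_bool (fst z = k) * exp ((snd z j - m k j)\<^sup>2 / 4)) \<partial>?S)"
    unfolding data_dist_def
    using i j measurable_sample_dist_class[OF j, of "\<lambda>y. exp ((y - m k j)\<^sup>2 / 4)" k K mu m]
    by (intro nn_integral_PiM_component[where f = "\<lambda>z. ennreal (of_bool (fst z = k) * exp ((snd z j - m k j)\<^sup>2 / 4))"]
        prob_space_axioms) auto
  also have "\<dots> = ennreal (mu k) * ennreal (sqrt 2)"
    using nn_integral_sample_dist_class[of K mu j p k "\<lambda>y. exp ((y - m k j)\<^sup>2 / 4)" m] mu j k
    by (simp add: exp_square_moment_normal)
  also have "\<dots> = ennreal (mu k * sqrt 2)" using mu k by (simp add: ennreal_mult)
  also have "\<dots> \<le> ennreal 2"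
    using mult_mono[of "mu k" 1 "sqrt 2" 2] \<open>mu k \<le> 1\<close> real_sqrt_le_mono[of 2 4] by (intro ennreal_leI) simp
  finally show ?thesis .
qed

subsection \<open>Deterministic error bounds\<close>

lemma vnorm_square: "(vnorm p x)\<^sup>2 = (\<Sum>j<p. (x j)\<^sup>2)"
  by (simp add: vnorm_def sum_nonneg)

lemma square_sum_le: "(a + b)\<^sup>2 \<le> 2 * a\<^sup>2 + 2 * b\<^sup>2" for a b :: real
proof -
  have "0 \<le> (a - b)\<^sup>2" by simp
  then show ?thesis unfolding power2_diff power2_sum by simp
qed

section \<open>Normalising the class frequencies\<close>

text \<open>Raising a frequency to \<open>c0\<close> does not increase its error, as
  \<open>mu j > 2 * c0\<close>. The error of the quotient is
  \<open>((b k - mu k) - mu k * (S - 1)) / S\<close>, where \<open>S \<ge> c0\<close> and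
  \<open>S - 1\<close> is a sum of such errors. Cauchy-Schwarz over the classes gives the factor
  \<open>K\<close>.\<close>

lemma mu_tilde_error:
  assumes c0: "c0 > 0" and mu: "\<And>j. j \<in> {1..K} \<Longrightarrow> mu j > 2 * c0" "(\<Sum>j=1..K. mu j) = 1" and k: "k \<in> {1..K}"
  shows "(mu_tilde K c0 v k - mu k)\<^sup>2 \<le> 4 * real K / c0\<^sup>2 * (\<Sum>j=1..K. (dec_mu K v j - mu j)\<^sup>2)"
proof -
  define b where "b j = max (dec_mu K v j) c0" for j
  define a where "a j = \<bar>dec_mu K v j - mu j\<bar>" for j
  define S where "S = (\<Sum>j=1..K. b j)"
  have ba: "\<bar>b j - mu j\<bar> \<le> a j" if "j \<in> {1..K}" for j
    using mu(1)[OF that] c0 unfolding a_def b_def by linarith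
  have "b k \<le> S" unfolding S_def using k c0 by (intro member_le_sum) (auto simp: b_def)
  then have S: "S \<ge> c0" unfolding b_def by linarith
  have "S - 1 = (\<Sum>j=1..K. b j - mu j)" using mu(2) by (simp add: S_def sum_subtractf)
  then have S1: "\<bar>S - 1\<bar> \<le> (\<Sum>j=1..K. a j)"
    using ba by (auto intro!: order_trans[OF sum_abs] sum_mono)
  have mu0: "0 \<le> mu j" if "j \<in> {1..K}" for j using mu(1)[OF that] c0 by linarith
  have muk: "0 \<le> mu k" "mu k \<le> 1"
    using mu0 k mu(2) member_le_sum[of k "{1..K}" mu] by auto
  have ak: "a k \<le> (\<Sum>j=1..K. a j)" using k by (intro member_le_sum) (auto simp: a_def)
  have "mu_tilde K c0 v k - mu k = ((b k - mu k) - mu k * (S - 1)) / S"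
    using S c0 by (simp add: mu_tilde_def S_def b_def field_simps)
  also have "\<bar>\<dots>\<bar> \<le> (\<bar>b k - mu k\<bar> + \<bar>mu k * (S - 1)\<bar>) / S"
    using S c0 by (simp add: abs_divide divide_right_mono abs_triangle_ineq4)
  also have "\<dots> \<le> ((\<Sum>j=1..K. a j) + (\<Sum>j=1..K. a j)) / S"
    using ba[OF k] ak muk S1 S c0 mult_mono[of "mu k" 1 "\<bar>S - 1\<bar>" "\<Sum>j=1..K. a j"]
    by (intro divide_right_mono add_mono) (auto simp: abs_mult)
  also have "\<dots> \<le> ((\<Sum>j=1..K. a j) + (\<Sum>j=1..K. a j)) / c0"
    using S c0 by (intro divide_left_mono) (auto intro!: sum_nonneg simp: a_def)
  also have "\<dots> = 2 / c0 * (\<Sum>j=1..K. a j)" by simp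
  finally have "\<bar>mu_tilde K c0 v k - mu k\<bar> \<le> 2 / c0 * (\<Sum>j=1..K. a j)" .
  then have "(mu_tilde K c0 v k - mu k)\<^sup>2 \<le> (2 / c0 * (\<Sum>j=1..K. a j))\<^sup>2"
    using abs_le_square_iff by (metis abs_ge_self order_trans)
  also have "\<dots> = 4 / c0\<^sup>2 * (\<Sum>j=1..K. a j)\<^sup>2" by (simp add: power_mult_distrib power_divide)
  also have "(\<Sum>j=1..K. a j)\<^sup>2 \<le> real K * (\<Sum>j=1..K. (a j)\<^sup>2)"
    using sum_squared_le_sum_of_squares[of a "{1..K}"] by (simp add: mult.commute)
  finally show ?thesis by (simp add: a_def mult_left_mono divide_right_mono)
qed

section \<open>Clipping to a ball\<close>

lemma proj_ball_norm:
  assumes "R > 0"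
  shows "(\<Sum>j<p. (proj_ball p R x j)\<^sup>2) \<le> R\<^sup>2"
proof -
  have "(\<Sum>j<p. (proj_ball p R x j)\<^sup>2) = (R * vnorm p x / max (vnorm p x) R)\<^sup>2"
    by (simp add: proj_ball_def power_mult_distrib power_divide vnorm_square
        flip: sum_divide_distrib sum_distrib_left)
  also have "\<dots> \<le> R\<^sup>2"
  proof (intro power_mono)
    show "R * vnorm p x / max (vnorm p x) R \<le> R"
      using assms by (simp add: divide_le_eq mult_left_mono)
    show "0 \<le> R * vnorm p x / max (vnorm p x) R"
      using assms by (simp add: vnorm_def sum_nonneg)
  qed
  finally show ?thesis .
qed

text \<open>Inside the ball nothing moves. Outside, the displacement is \<open>x\<close> times a
  factor between -1 and 0, so it is no longer than \<open>x\<close> itself.\<close>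

lemma proj_ball_error:
  assumes "R > 0"
  shows "(\<Sum>j<p. (proj_ball p R x j - x j)\<^sup>2) \<le> (if R < vnorm p x then (vnorm p x)\<^sup>2 else 0)"
proof (cases "R < vnorm p x")
  case True
  have "(proj_ball p R x j - x j)\<^sup>2 \<le> (x j)\<^sup>2" for j
  proof -
    have "proj_ball p R x j - x j = - ((1 - R / vnorm p x) * x j)"
      using True by (simp add: proj_ball_def field_simps)
    then have "(proj_ball p R x j - x j)\<^sup>2 = (1 - R / vnorm p x)\<^sup>2 * (x j)\<^sup>2"
      by (simp add: power_mult_distrib)
    also have "\<dots> \<le> 1 * (x j)\<^sup>2"
      using True assms by (intro mult_right_mono power_le_one) (auto simp: field_simps)
    finally show ?thesis by simp
  qed
  then show ?thesis using True by (auto simp: vnorm_square intro: sum_mono)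
next
  case False
  then have "proj_ball p R x j = x j" for j
    using assms by (simp add: proj_ball_def max_def)
  then show ?thesis using False by simp
qed

text \<open>A clipped \<open>x\<close> lies so far from \<open>a\<close> that the mean squared
  deviation \<open>h\<close> per coordinate is at least \<open>8 * ln n\<close>, that is,
  \<open>exp (h / 8) \<ge> n\<close>. Of the two factors in \<open>exp (h / 4)\<close>, one pays for
  the division by \<open>n\<close>, the other dominates the terms linear in \<open>h\<close> that
  bound the squared norm of \<open>x\<close>. Jensen's inequality then replaces
  \<open>exp (h / 4)\<close> by an average over coordinates.\<close>

lemma proj_ball_error_exp:
  assumes Cm: "Cm \<ge> 2" and p: "p \<ge> 1" and n: "n \<ge> 3" and a: "vnorm p a \<le> Cm * sqrt (real p)"
  shows "(\<Sum>j<p. (proj_ball p (4 * Cm * sqrt (real p * ln (real n))) x j - x j)\<^sup>2)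
    \<le> (2 * Cm\<^sup>2 + 16) / n * (\<Sum>j<p. exp ((x j - a j)\<^sup>2 / 4))"
proof -
  let ?L = "ln (real n)" and ?R = "4 * Cm * sqrt (real p * ln (real n))"
  have "exp 1 \<le> real n" using exp_le n by linarith
  then have L: "?L \<ge> 1" using n by (simp add: ln_ge_iff)
  have R: "?R > 0" using Cm p L by simp
  define h where "h = (\<Sum>j<p. (x j - a j)\<^sup>2) / p"
  have h0: "h \<ge> 0" by (simp add: h_def sum_nonneg)
  have "(vnorm p a)\<^sup>2 \<le> (Cm * sqrt (real p))\<^sup>2"
    using a by (intro power_mono) (auto simp: vnorm_def sum_nonneg)
  then have a2: "(vnorm p a)\<^sup>2 \<le> Cm\<^sup>2 * p" by (simp add: power_mult_distrib)
  have "(vnorm p x)\<^sup>2 \<le> (\<Sum>j<p. 2 * (a j)\<^sup>2 + 2 * (x j - a j)\<^sup>2)"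
    unfolding vnorm_square
    by (rule sum_mono) (use square_sum_le[of "a j" "x j - a j" for j] in simp)
  also have "\<dots> = 2 * (vnorm p a)\<^sup>2 + 2 * (p * h)"
    using p by (simp add: sum.distrib vnorm_square h_def flip: sum_distrib_left)
  finally have x2: "(vnorm p x)\<^sup>2 \<le> 2 * (Cm\<^sup>2 * p) + 2 * (p * h)" using a2 by linarith
  have jensen: "exp (h / 4) \<le> (\<Sum>j<p. exp ((x j - a j)\<^sup>2 / 4)) / p"
  proof -
    have "exp (\<Sum>j<p. (1 / p) *\<^sub>R ((x j - a j)\<^sup>2 / 4)) \<le> (\<Sum>j<p. (1 / p) * exp ((x j - a j)\<^sup>2 / 4))"
      using p by (intro convex_on_sum[OF _ _ exp_convex]) (auto simp: lessThan_empty_iff)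
    moreover have "(\<Sum>j<p. (1 / p) *\<^sub>R ((x j - a j)\<^sup>2 / 4)) = h / 4"
      by (simp add: h_def field_simps flip: sum_divide_distrib)
    ultimately show ?thesis by (simp only: flip: sum_distrib_left) simp
  qed
  have main: "(vnorm p x)\<^sup>2 \<le> (2 * Cm\<^sup>2 + 16) / n * (p * exp (h / 4))" if "?R < vnorm p x"
  proof -
    have "?R\<^sup>2 < (vnorm p x)\<^sup>2" using that R by (intro power_strict_mono) auto
    moreover have "?R\<^sup>2 = 16 * Cm\<^sup>2 * (p * ?L)"
      using L by (simp add: power_mult_distrib)
    ultimately have "16 * Cm\<^sup>2 * (p * ?L) < 2 * (Cm\<^sup>2 * p) + 2 * (p * h)" using x2 by linarith
    then have "real p * (16 * Cm\<^sup>2 * ?L) < p * (2 * Cm\<^sup>2 + 2 * h)" by (simp add: algebra_simps)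
    then have "16 * Cm\<^sup>2 * ?L < 2 * Cm\<^sup>2 + 2 * h" using p by simp
    moreover have "Cm\<^sup>2 * 1 \<le> Cm\<^sup>2 * ?L" using L by (intro mult_left_mono) auto
    moreover have "4 * ?L \<le> Cm\<^sup>2 * ?L" using L Cm power_mono[of 2 Cm 2] by (intro mult_right_mono) auto
    \<comment> \<open>The three inequalities even give \<open>28 * ?L < h\<close>, by
      \<open>Cm\<^sup>2 \<ge> 4\<close>. The value 8 is what makes \<open>exp (h / 8)\<close>, the
      square root of \<open>exp (h / 4)\<close>, reach \<open>n\<close>.\<close>
    ultimately have "8 * ?L \<le> h" using L by linarith
    then have "?L \<le> h / 8" by simp
    then have n8: "n \<le> exp (h / 8)" using n by (simp add: ln_le_cancel_iff[symmetric] flip: ln_ge_iff)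
    have h8: "h \<le> 8 * exp (h / 8)" using exp_ge_add_one_self[of "h / 8"] by linarith
    have "2 * (Cm\<^sup>2 * p) + 2 * (p * h) = p * (2 * Cm\<^sup>2 + 2 * h)" by (simp add: algebra_simps)
    also have "\<dots> \<le> p * ((2 * Cm\<^sup>2 + 16) * exp (h / 8))"
    proof (intro mult_left_mono)
      have "2 * Cm\<^sup>2 * 1 \<le> 2 * Cm\<^sup>2 * exp (h / 8)" using h0 by (intro mult_left_mono) auto
      then show "2 * Cm\<^sup>2 + 2 * h \<le> (2 * Cm\<^sup>2 + 16) * exp (h / 8)" using h8 by (simp add: algebra_simps)
    qed simp
    also have "\<dots> \<le> p * ((2 * Cm\<^sup>2 + 16) * (exp (h / 8) * exp (h / 8) / n))"
    proof (intro mult_left_mono)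
      show "exp (h / 8) \<le> exp (h / 8) * exp (h / 8) / n" using n8 n by (simp add: field_simps)
    qed auto
    also have "exp (h / 8) * exp (h / 8) = exp (h / 4)" by (simp flip: exp_add)
    finally show ?thesis using x2 by (simp add: field_simps)
  qed
  have "(\<Sum>j<p. (proj_ball p ?R x j - x j)\<^sup>2) \<le> (2 * Cm\<^sup>2 + 16) / n * (p * exp (h / 4))"
    by (rule order_trans[OF proj_ball_error[OF R]]) (use main in auto)
  also have "\<dots> \<le> (2 * Cm\<^sup>2 + 16) / n * (\<Sum>j<p. exp ((x j - a j)\<^sup>2 / 4))"
    using jensen p by (intro mult_left_mono) (auto simp: field_simps)
  finally show ?thesis .
qed

section \<open>Empirical class means\<close>

lemma class_idx_eq: "class_idx n z k = {i \<in> {..<n}. fst (z i) = k}"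
  by (auto simp: class_idx_def)

text \<open>Rewrites a sum over a random index set in the indicator form for which the moments were
  computed.\<close>

lemma sum_class_idx:
  fixes f :: "nat \<Rightarrow> real"
  shows "(\<Sum>i\<in>class_idx n z k. f i) = (\<Sum>i<n. of_bool (fst (z i) = k) * f i)"
proof -
  have "(\<Sum>i\<in>class_idx n z k. f i) = (\<Sum>i<n. if fst (z i) = k then f i else 0)"
    unfolding class_idx_eq by (rule sum.inter_filter) simp
  also have "\<dots> = (\<Sum>i<n. of_bool (fst (z i) = k) * f i)"
    by (intro sum.cong) auto
  finally show ?thesis .
qed

lemma card_class_idx: "real (card (class_idx n z k)) = (\<Sum>i<n. of_bool (fst (z i) = k))"
  using sum_class_idx[of "\<lambda>_. 1" n z k] by simp

text \<open>The error is the average clipping displacement plus the average deviation from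
  \<open>a\<close>. Cauchy-Schwarz moves the square inside the first sum, where no cancellation is
  expected; in the second the square stays outside, so that centring can be exploited.\<close>

lemma m_hat_error:
  assumes N: "card (class_idx n z k) > 0"
  shows "(\<Sum>j<p. (m_hat n p R z k j - a j)\<^sup>2)
    \<le> 2 / card (class_idx n z k) * (\<Sum>i<n. of_bool (fst (z i) = k) * (\<Sum>j<p. (proj_ball p R (snd (z i)) j - snd (z i) j)\<^sup>2))
      + 2 / (card (class_idx n z k))\<^sup>2 * (\<Sum>j<p. (\<Sum>i<n. of_bool (fst (z i) = k) * (snd (z i) j - a j))\<^sup>2)"
proof -
  define I where "I = class_idx n z k"
  define N where "N = real (card I)"
  have N0: "N > 0" using N by (simp add: N_def I_def)
  have I: "I \<noteq> {}" using N by (auto simp: I_def)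
  have "(m_hat n p R z k j - a j)\<^sup>2 \<le> 2 / N * (\<Sum>i\<in>I. (proj_ball p R (snd (z i)) j - snd (z i) j)\<^sup>2)
     + 2 / N\<^sup>2 * (\<Sum>i\<in>I. snd (z i) j - a j)\<^sup>2" for j
  proof -
    define A where "A = (\<Sum>i\<in>I. proj_ball p R (snd (z i)) j - snd (z i) j)"
    define B where "B = (\<Sum>i\<in>I. snd (z i) j - a j)"
    have "m_hat n p R z k j = (\<Sum>i\<in>I. proj_ball p R (snd (z i)) j) / N"
      using I by (simp add: m_hat_def I_def N_def)
    then have "m_hat n p R z k j - a j = A / N + B / N"
      using N0 by (simp add: A_def B_def sum_subtractf field_simps N_def)
    then have "(m_hat n p R z k j - a j)\<^sup>2 \<le> 2 * (A\<^sup>2 / N\<^sup>2) + 2 * (B\<^sup>2 / N\<^sup>2)"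
      using square_sum_le[of "A / N" "B / N"] by (simp add: power_divide)
    also have "A\<^sup>2 \<le> N * (\<Sum>i\<in>I. (proj_ball p R (snd (z i)) j - snd (z i) j)\<^sup>2)"
      unfolding A_def N_def by (subst mult.commute) (rule sum_squared_le_sum_of_squares)
    also have "2 * (N * (\<Sum>i\<in>I. (proj_ball p R (snd (z i)) j - snd (z i) j)\<^sup>2) / N\<^sup>2)
      = 2 / N * (\<Sum>i\<in>I. (proj_ball p R (snd (z i)) j - snd (z i) j)\<^sup>2)"
      by (simp add: power2_eq_square)
    finally show ?thesis using N0 by (simp add: B_def divide_right_mono)
  qed
  then have "(\<Sum>j<p. (m_hat n p R z k j - a j)\<^sup>2)
    \<le> (\<Sum>j<p. 2 / N * (\<Sum>i\<in>I. (proj_ball p R (snd (z i)) j - snd (z i) j)\<^sup>2)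
     + 2 / N\<^sup>2 * (\<Sum>i\<in>I. snd (z i) j - a j)\<^sup>2)" by (intro sum_mono)
  also have "\<dots> = 2 / N * (\<Sum>i\<in>I. \<Sum>j<p. (proj_ball p R (snd (z i)) j - snd (z i) j)\<^sup>2)
     + 2 / N\<^sup>2 * (\<Sum>j<p. (\<Sum>i\<in>I. snd (z i) j - a j)\<^sup>2)"
    by (simp add: sum.distrib sum_distrib_left sum.swap[of _ I])
  finally show ?thesis by (simp add: I_def N_def sum_class_idx)
qed

text \<open>An average of points of a ball stays in the ball, and so does the default value 0 of an
  empty class.\<close>

lemma m_hat_norm:
  assumes R: "R > 0"
  shows "(\<Sum>j<p. (m_hat n p R z k j)\<^sup>2) \<le> R\<^sup>2"
proof (cases "class_idx n z k = {}")
  case True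
  then show ?thesis by (simp add: m_hat_def)
next
  case False
  define I where "I = class_idx n z k"
  define N where "N = real (card I)"
  have "finite I" by (simp add: I_def class_idx_eq)
  then have N0: "N > 0" using False by (simp add: N_def I_def card_gt_0_iff)
  have "(\<Sum>j<p. (m_hat n p R z k j)\<^sup>2) = (\<Sum>j<p. (\<Sum>i\<in>I. proj_ball p R (snd (z i)) j)\<^sup>2) / N\<^sup>2"
    using False by (simp add: m_hat_def I_def N_def power_divide flip: sum_divide_distrib)
  also have "\<dots> \<le> (\<Sum>j<p. (\<Sum>i\<in>I. (proj_ball p R (snd (z i)) j)\<^sup>2) * N) / N\<^sup>2"
    unfolding N_def by (intro divide_right_mono sum_mono sum_squared_le_sum_of_squares) auto
  also have "\<dots> = (\<Sum>i\<in>I. \<Sum>j<p. (proj_ball p R (snd (z i)) j)\<^sup>2) / N"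
    by (simp add: sum.swap[of _ I] power2_eq_square flip: sum_distrib_right)
  also have "\<dots> \<le> (\<Sum>i\<in>I. R\<^sup>2) / N"
    using N0 R by (intro divide_right_mono sum_mono proj_ball_norm) auto
  also have "\<dots> = R\<^sup>2" using N0 by (simp add: N_def)
  finally show ?thesis .
qed

section \<open>Reply probability\<close>

text \<open>At \<open>\<gamma> = 0\<close> the odds of a reply are
  \<open>exp (- \<epsilon> / 2)\<close> divided by a maximum that is at least
  \<open>1 / \<delta>\<close>, and a probability is at most its odds.\<close>

lemma ePTR_prob_zero_le:
  assumes "\<epsilon> > 0" "\<delta> > 0"
  shows "ePTR_prob \<epsilon> \<delta> 0 \<le> \<delta>"
proof -
  let ?m = "max (1 / \<delta>) (1 / \<epsilon>)" and ?e = "exp (\<epsilon> / 2 * (0 - ePTR_M \<epsilon> \<delta>))"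
  have m: "?m > 0" using assms by (simp add: less_max_iff_disj)
  have "\<epsilon> / 2 * (0 - ePTR_M \<epsilon> \<delta>) = - \<epsilon> / 2 - ln ?m"
    using assms by (simp add: ePTR_M_def field_simps)
  then have "?e \<le> exp (- ln ?m)" using assms by simp
  also have "\<dots> = 1 / ?m" using m by (simp add: exp_minus divide_inverse)
  also have "\<dots> \<le> 1 / (1 / \<delta>)" using assms m by (intro divide_left_mono) auto
  finally have e: "?e \<le> \<delta>" by simp
  have "ePTR_prob \<epsilon> \<delta> 0 \<le> ?e / 1"
    unfolding ePTR_prob_def by (intro divide_left_mono) (auto intro: add_pos_pos)
  then show ?thesis using e by simp
qed

lemma ePTR_prob_bounds: "0 \<le> ePTR_prob \<epsilon> \<delta> g" "ePTR_prob \<epsilon> \<delta> g \<le> 1"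
  by (simp_all add: ePTR_prob_def add_nonneg_pos less_imp_le divide_le_eq_1 add_pos_pos)


section \<open>Bounds for one admissible choice of the parameters\<close>

locale eptr_setting =
  fixes K n p :: nat and c0 Cm \<epsilon> \<delta> :: real and mu :: "nat \<Rightarrow> real" and m :: "nat \<Rightarrow> nat \<Rightarrow> real"
  assumes c0: "c0 > 0" and Cm: "Cm \<ge> 2"
    and mu_sum: "(\<Sum>k=1..K. mu k) = 1"
    and mu_gt: "k \<in> {1..K} \<Longrightarrow> mu k > 2 * c0"
    and m_norm: "k \<in> {1..K} \<Longrightarrow> vnorm p (m k) \<le> Cm * sqrt p"
    and eps: "0 < \<epsilon>" and delta: "0 < \<delta>" "\<delta> < 1 / real n ^ 3"
    and n: "n \<ge> 3" and p: "p \<ge> 1"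
    and n_large: "real n \<ge> 4 / c0 + 8 / (c0 * \<epsilon>) * ln (1 / \<delta>)"
begin

definition Rx :: real where "Rx = 4 * Cm * sqrt (p * ln n)"

lemma K_pos: "K \<ge> 1"
  using mu_sum by (cases K) auto

lemma mu_nonneg: "k \<in> {1..K} \<Longrightarrow> mu k \<ge> 0"
  using mu_gt[of k] c0 by linarith

lemma mu_le_1: "k \<in> {1..K} \<Longrightarrow> mu k \<le> 1"
  using mu_sum mu_nonneg member_le_sum[of k "{1..K}" mu] by simp

lemma c0_less: "c0 < 1 / 2"
  using K_pos mu_le_1[of 1] mu_gt[of 1] by simp

lemma ln_n: "ln n \<ge> 1" "ln n \<le> n"
proof -
  have "exp 1 \<le> real n" using exp_le n by linarith
  then show "ln n \<ge> 1" using n by (simp add: ln_ge_iff)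
  show "ln n \<le> n" using ln_le_minus_one[of "real n"] n by simp
qed

lemma n_cube: "real n \<le> real n ^ 3"
  using n self_le_power[of "real n" 3] by simp

text \<open>This weaker form of the bound on \<open>\<delta>\<close> decides the maximum in
  \<open>ePTR_M\<close> and turns reply odds of \<open>1 / \<delta>\<close> into a no-reply
  probability of at most \<open>1 / n\<close>.\<close>

lemma n_less_inverse_delta: "real n < 1 / \<delta>"
proof -
  have "real n ^ 3 < 1 / \<delta>" using delta n by (simp add: field_simps)
  then show ?thesis using n_cube by linarith
qed

lemma ln_delta: "ln (1 / \<delta>) \<ge> 1"
proof -
  have "ln n \<le> ln (1 / \<delta>)" using n_less_inverse_delta n delta by (subst ln_le_cancel_iff) auto
  then show ?thesis using ln_n by linarith
qed

lemma Rx_pos: "Rx > 0"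
proof -
  have "0 < p * ln n" using p ln_n(1) by (intro mult_pos_pos) (simp_all del: ln_gt_zero_iff)
  then show ?thesis using Cm by (simp add: Rx_def)
qed

lemma Rx_square: "Rx\<^sup>2 = 16 * Cm\<^sup>2 * (p * ln n)"
  using ln_n by (simp add: Rx_def power_mult_distrib)

lemma m_square: "k \<in> {1..K} \<Longrightarrow> (\<Sum>j<p. (m k j)\<^sup>2) \<le> Cm\<^sup>2 * p"
proof -
  assume "k \<in> {1..K}"
  then have "(vnorm p (m k))\<^sup>2 \<le> (Cm * sqrt p)\<^sup>2"
    by (intro power_mono m_norm) (simp_all add: vnorm_def sum_nonneg)
  then show ?thesis by (simp add: power_mult_distrib vnorm_square)
qed

text \<open>This is where the sample size condition enters. If all frequencies are within
  \<open>c0 / 2\<close> of their targets, every class has at least \<open>3 / 2 * c0 * n\<close>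
  points and the reply odds reach \<open>1 / \<delta>\<close>. Otherwise the right-hand side is at
  least 1.\<close>

lemma no_reply_prob:
  "1 - ePTR_prob \<epsilon> \<delta> (gamma_fn n K c0 z) \<le> 1 / n + 4 / c0\<^sup>2 * (\<Sum>k=1..K. (mu_hat n z k - mu k)\<^sup>2)"
proof (cases "\<forall>k\<in>{1..K}. \<bar>mu_hat n z k - mu k\<bar> \<le> c0 / 2")
  case True
  let ?g = "gamma_fn n K c0 z" and ?L = "ln (1 / \<delta>)"
  let ?e = "exp (\<epsilon> / 2 * (?g - ePTR_M \<epsilon> \<delta>))"
  have "3 / 2 * c0 * n \<le> card (class_idx n z k)" if k: "k \<in> {1..K}" for k
  proof -
    have "3 / 2 * c0 \<le> mu_hat n z k" using True[rule_format, OF k] mu_gt[OF k] by linarith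
    then show ?thesis using n by (simp add: mu_hat_def field_simps)
  qed
  then have "3 / 2 * c0 * n \<le> Min ((\<lambda>k. card (class_idx n z k)) ` {1..K})"
    using Min_in[of "(\<lambda>k. card (class_idx n z k)) ` {1..K}"] K_pos by fastforce
  then have "c0 * n / 2 - 1 \<le> ?g" by (simp add: gamma_fn_def)
  \<comment> \<open>After halving, the 4 becomes 2 and pays for the two ones subtracted in
    \<open>gamma_fn\<close> and in \<open>ePTR_M\<close>. The 8 leaves \<open>2 * ?L\<close> in the
    exponent: one \<open>?L\<close> cancels the logarithm in \<open>ePTR_M\<close>, the other makes
    the odds large.\<close>
  moreover have "4 + 8 / \<epsilon> * ?L \<le> c0 * n"
    using mult_left_mono[OF n_large, of c0] c0 by (simp add: algebra_simps)
  ultimately have "4 / \<epsilon> * ?L \<le> ?g - 1" by simp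
  then have "\<epsilon> / 2 * (4 / \<epsilon> * ?L) \<le> \<epsilon> / 2 * (?g - 1)" using eps by (intro mult_left_mono) auto
  then have a: "2 * ?L \<le> \<epsilon> / 2 * (?g - 1)" using eps by simp
  \<comment> \<open>Together with \<open>n < 1 / \<delta>\<close> this shows that the maximum inside
    \<open>ePTR_M\<close> is \<open>1 / \<delta>\<close>.\<close>
  have "1 / \<epsilon> \<le> n"
  proof -
    have "1 \<le> 8 * ?L / c0" using c0 c0_less ln_delta by (simp add: field_simps)
    then have "1 / \<epsilon> * 1 \<le> 1 / \<epsilon> * (8 * ?L / c0)" using eps by (intro mult_left_mono) auto
    also have "\<dots> = 8 / (c0 * \<epsilon>) * ?L" by simp
    also have "\<dots> \<le> n" using n_large c0 by (smt (verit) divide_pos_pos)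
    finally show ?thesis by simp
  qed
  then have "max (1 / \<delta>) (1 / \<epsilon>) = 1 / \<delta>" using n_less_inverse_delta by simp
  then have "\<epsilon> / 2 * (?g - ePTR_M \<epsilon> \<delta>) = \<epsilon> / 2 * (?g - 1) - ?L"
    using eps by (simp add: ePTR_M_def field_simps)
  then have "?L \<le> \<epsilon> / 2 * (?g - ePTR_M \<epsilon> \<delta>)" using a by linarith
  then have "exp ?L \<le> ?e" by simp
  then have e: "n \<le> ?e" using n_less_inverse_delta delta by simp
  have "1 - ePTR_prob \<epsilon> \<delta> ?g = 1 / (?e + 1)"
    unfolding ePTR_prob_def by (simp add: field_simps add_pos_pos less_imp_neq[symmetric])
  also have "\<dots> \<le> 1 / n" using e n by (intro divide_left_mono) (auto intro: add_pos_pos)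
  finally show ?thesis by (simp add: add_increasing2 sum_nonneg)
next
  case False
  then obtain k where k: "k \<in> {1..K}" "c0 / 2 < \<bar>mu_hat n z k - mu k\<bar>" by auto
  have "(c0 / 2)\<^sup>2 \<le> \<bar>mu_hat n z k - mu k\<bar>\<^sup>2" using k c0 by (intro power_mono) auto
  also have "\<dots> \<le> (\<Sum>k=1..K. (mu_hat n z k - mu k)\<^sup>2)"
    using k by (simp add: member_le_sum[where f = "\<lambda>k. (mu_hat n z k - mu k)\<^sup>2"])
  finally have "1 \<le> 4 / c0\<^sup>2 * (\<Sum>k=1..K. (mu_hat n z k - mu k)\<^sup>2)"
    using c0 by (simp add: field_simps)
  moreover have "1 - ePTR_prob \<epsilon> \<delta> (gamma_fn n K c0 z) \<le> 1" using ePTR_prob_bounds by simp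
  moreover have "0 \<le> 1 / real n" by simp
  ultimately show ?thesis by linarith
qed

text \<open>The factor \<open>ePTR_prob\<close> lets the bound hold for every data set: it is tiny
  exactly when a class may be too small for its mean to be controlled. The case split is at
  \<open>c0 * n + 1\<close>, at or below which \<open>gamma_fn\<close> is 0.\<close>

lemma reply_m_hat_error:
  assumes k: "k \<in> {1..K}"
  shows "ePTR_prob \<epsilon> \<delta> (gamma_fn n K c0 z) * (\<Sum>j<p. (m_hat n p Rx z k j - m k j)\<^sup>2)
    \<le> 34 * Cm\<^sup>2 * (p / n)
      + (4 * Cm\<^sup>2 + 32) / (c0 * n\<^sup>2) * (\<Sum>i<n. \<Sum>j<p. of_bool (fst (z i) = k) * exp ((snd (z i) j - m k j)\<^sup>2 / 4))
      + 2 / (c0\<^sup>2 * n\<^sup>2) * (\<Sum>j<p. (\<Sum>i<n. of_bool (fst (z i) = k) * (snd (z i) j - m k j))\<^sup>2)"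
    (is "?P * ?E \<le> ?A + ?B + ?C")
proof -
  let ?N = "real (card (class_idx n z k))"
  have A: "?A \<ge> 0" by simp
  have B: "?B \<ge> 0" using c0 by (intro mult_nonneg_nonneg sum_nonneg) auto
  have C: "?C \<ge> 0" by (intro mult_nonneg_nonneg sum_nonneg) auto
  have E: "?E \<ge> 0" by (intro sum_nonneg) auto
  show ?thesis
  proof (cases "?N \<le> c0 * n + 1")
    case True
    have "Min ((\<lambda>k. card (class_idx n z k)) ` {1..K}) \<le> card (class_idx n z k)"
      using k by (intro Min_le) auto
    then have "gamma_fn n K c0 z = 0" using True by (simp add: gamma_fn_def)
    then have "?P \<le> \<delta>" using ePTR_prob_zero_le eps delta by simp
    then have P: "?P \<le> 1 / real n ^ 3" using delta by linarith
    have "?E \<le> (\<Sum>j<p. 2 * (m_hat n p Rx z k j)\<^sup>2 + 2 * (m k j)\<^sup>2)"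
      by (rule sum_mono) (use square_sum_le[of "m_hat n p Rx z k j" "- m k j" for j] in simp)
    also have "\<dots> \<le> 2 * Rx\<^sup>2 + 2 * (Cm\<^sup>2 * p)"
      using m_hat_norm[OF Rx_pos, of n p z k] m_square[OF k]
      by (simp add: sum.distrib flip: sum_distrib_left)
    also have "\<dots> = Cm\<^sup>2 * p * (32 * ln n + 2)" by (simp add: Rx_square algebra_simps)
    \<comment> \<open>The crude \<open>ln n \<le> n\<close> is affordable: the reply probability
      contributes the inverse cube of \<open>n\<close>, and only one inverse power is kept in the
      end.\<close>
    also have "\<dots> \<le> Cm\<^sup>2 * p * (34 * n)" using ln_n n by (intro mult_left_mono) auto
    finally have "?P * ?E \<le> 1 / real n ^ 3 * (Cm\<^sup>2 * p * (34 * n))"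
      using P E by (intro mult_mono) auto
    also have "\<dots> = 34 * Cm\<^sup>2 * (p / n) * (1 / n)"
      using n by (simp add: field_simps power3_eq_cube)
    also have "\<dots> \<le> ?A" using n by (intro mult_right_le_one_le) auto
    finally show ?thesis using B C by linarith
  next
    case False
    then have N: "?N \<ge> c0 * n" by simp
    have c0n: "c0 * n > 0" using c0 n by simp
    have "?P * ?E \<le> ?E" using ePTR_prob_bounds E by (intro mult_left_le_one_le) auto
    also have "\<dots> \<le> 2 / ?N * (\<Sum>i<n. of_bool (fst (z i) = k) * (\<Sum>j<p. (proj_ball p Rx (snd (z i)) j - snd (z i) j)\<^sup>2))
      + 2 / ?N\<^sup>2 * (\<Sum>j<p. (\<Sum>i<n. of_bool (fst (z i) = k) * (snd (z i) j - m k j))\<^sup>2)"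
      using N c0n by (intro order_trans[OF m_hat_error]) auto
    \<comment> \<open>The random class size is replaced by its deterministic lower bound, so that
      only the numerators remain to be averaged.\<close>
    also have "\<dots> \<le> 2 / (c0 * n) * (\<Sum>i<n. of_bool (fst (z i) = k) *
        ((2 * Cm\<^sup>2 + 16) / n * (\<Sum>j<p. exp ((snd (z i) j - m k j)\<^sup>2 / 4))))
      + 2 / (c0 * n)\<^sup>2 * (\<Sum>j<p. (\<Sum>i<n. of_bool (fst (z i) = k) * (snd (z i) j - m k j))\<^sup>2)"
    proof (rule add_mono)
      have "(\<Sum>j<p. (proj_ball p Rx (snd (z i)) j - snd (z i) j)\<^sup>2)
        \<le> (2 * Cm\<^sup>2 + 16) / n * (\<Sum>j<p. exp ((snd (z i) j - m k j)\<^sup>2 / 4))" for i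
        using proj_ball_error_exp[OF Cm p n m_norm[OF k], of "snd (z i)"] by (simp add: Rx_def)
      then show "2 / ?N * (\<Sum>i<n. of_bool (fst (z i) = k) * (\<Sum>j<p. (proj_ball p Rx (snd (z i)) j - snd (z i) j)\<^sup>2))
        \<le> 2 / (c0 * n) * (\<Sum>i<n. of_bool (fst (z i) = k) *
          ((2 * Cm\<^sup>2 + 16) / n * (\<Sum>j<p. exp ((snd (z i) j - m k j)\<^sup>2 / 4))))"
        using N c0n by (intro mult_mono sum_mono divide_left_mono) (auto intro!: sum_nonneg)
      have "2 / ?N\<^sup>2 \<le> 2 / (c0 * n)\<^sup>2"
        by (intro frac_le power_mono N zero_less_power c0n less_imp_le[OF c0n]) auto
      then show "2 / ?N\<^sup>2 * (\<Sum>j<p. (\<Sum>i<n. of_bool (fst (z i) = k) * (snd (z i) j - m k j))\<^sup>2)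
        \<le> 2 / (c0 * n)\<^sup>2 * (\<Sum>j<p. (\<Sum>i<n. of_bool (fst (z i) = k) * (snd (z i) j - m k j))\<^sup>2)"
        by (intro mult_right_mono sum_nonneg) auto
    qed
    also have "\<dots> = ?B + ?C"
    proof -
      have "(\<Sum>i<n. of_bool (fst (z i) = k) * ((2 * Cm\<^sup>2 + 16) / n * (\<Sum>j<p. exp ((snd (z i) j - m k j)\<^sup>2 / 4))))
        = (2 * Cm\<^sup>2 + 16) / n * (\<Sum>i<n. \<Sum>j<p. of_bool (fst (z i) = k) * exp ((snd (z i) j - m k j)\<^sup>2 / 4))"
        by (simp only: sum_distrib_left mult.left_commute)
      moreover have "2 / (c0 * n) * ((2 * Cm\<^sup>2 + 16) / n * S) = (4 * Cm\<^sup>2 + 32) / (c0 * n\<^sup>2) * S" for S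
        using c0 n by (simp add: power2_eq_square[of "real n"] field_simps)
      ultimately show ?thesis by (simp only: power_mult_distrib of_nat_power)
    qed
    finally show ?thesis using A by linarith
  qed
qed

text \<open>At the zero vector every frequency is raised to \<open>c0\<close>, so the normalised
  frequencies are all \<open>1 / K\<close>; the remaining loss is the squared norm of
  \<open>m k\<close>. Since \<open>p \<ge> 1\<close>, the frequency error of at most 1 fits into a
  multiple of \<open>p\<close>.\<close>

lemma est_loss_zero: "est_loss K p c0 mu m (\<lambda>_. 0) \<le> real K * ((1 + Cm\<^sup>2) * p)"
proof -
  have "(mu_tilde K c0 (\<lambda>_. 0) k - mu k)\<^sup>2 + (vnorm p (\<lambda>j. dec_m K p (\<lambda>_. 0) k j - m k j))\<^sup>2 \<le> (1 + Cm\<^sup>2) * p"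
    if k: "k \<in> {1..K}" for k
  proof -
    have "mu_tilde K c0 (\<lambda>_. 0) k = 1 / K"
      using c0 by (simp add: mu_tilde_def dec_mu_def)
    then have "0 \<le> mu_tilde K c0 (\<lambda>_. 0) k" "mu_tilde K c0 (\<lambda>_. 0) k \<le> 1"
      using K_pos by auto
    then have "\<bar>mu_tilde K c0 (\<lambda>_. 0) k - mu k\<bar> \<le> 1"
      using mu_nonneg[OF k] mu_le_1[OF k] by linarith
    then have "(mu_tilde K c0 (\<lambda>_. 0) k - mu k)\<^sup>2 \<le> 1" by (simp add: abs_square_le_1)
    moreover have "(vnorm p (\<lambda>j. dec_m K p (\<lambda>_. 0) k j - m k j))\<^sup>2 \<le> Cm\<^sup>2 * p"
      using m_square[OF k] by (simp add: vnorm_square dec_m_def)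
    moreover have "1 \<le> real p" using p by simp
    ultimately show ?thesis by (simp add: algebra_simps)
  qed
  then have "est_loss K p c0 mu m (\<lambda>_. 0) \<le> (\<Sum>k=1..K. (1 + Cm\<^sup>2) * p)"
    unfolding est_loss_def by (intro sum_mono) auto
  then show ?thesis by simp
qed

text \<open>Places the block of class \<open>k\<close> inside the encoded vector, away from the
  default branch of \<open>theta_hat\<close>.\<close>

lemma m_index_less:
  assumes "k \<in> {1..K}" "j < p"
  shows "K + (k - 1) * p + j < K * (p + 1)"
proof -
  have "(k - 1) * p + j < (k - 1) * p + p" using assms by simp
  also have "\<dots> = k * p" using assms by (cases k) auto
  also have "\<dots> \<le> K * p" using assms by simp
  finally show ?thesis by simp
qed

text \<open>The error of the noise-free estimate; the weight is the constant of
  \<open>mu_tilde_error\<close> summed over the \<open>K\<close> classes.\<close>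

definition hat_loss :: "(nat \<Rightarrow> nat \<times> (nat \<Rightarrow> real)) \<Rightarrow> real" where
  "hat_loss z = 4 * (real K)\<^sup>2 / c0\<^sup>2 * (\<Sum>k=1..K. (mu_hat n z k - mu k)\<^sup>2)
    + (\<Sum>k=1..K. \<Sum>j<p. (m_hat n p Rx z k j - m k j)\<^sup>2)"

text \<open>Undoing the normalisation first makes the loss a sum of squares of estimation error plus
  noise; each is at most twice the two squares.\<close>

lemma est_loss_noisy:
  "est_loss K p c0 mu m (\<lambda>i. theta_hat n K p Rx z i + s * \<zeta> i)
    \<le> 2 * hat_loss z + 2 * s\<^sup>2 * (4 * (real K)\<^sup>2 / c0\<^sup>2 * (\<Sum>k=1..K. (\<zeta> (k - 1))\<^sup>2)
        + (\<Sum>k=1..K. \<Sum>j<p. (\<zeta> (K + (k - 1) * p + j))\<^sup>2))"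
proof -
  let ?v = "\<lambda>i. theta_hat n K p Rx z i + s * \<zeta> i"
  have mu': "(dec_mu K ?v k - mu k)\<^sup>2 \<le> 2 * (mu_hat n z k - mu k)\<^sup>2 + 2 * s\<^sup>2 * (\<zeta> (k - 1))\<^sup>2"
    if "k \<in> {1..K}" for k
  proof -
    have "dec_mu K ?v k - mu k = (mu_hat n z k - mu k) + s * \<zeta> (k - 1)"
      using that by (auto simp: dec_mu_def theta_hat_def)
    then show ?thesis using square_sum_le[of "mu_hat n z k - mu k" "s * \<zeta> (k - 1)"]
      by (simp only: power_mult_distrib mult.assoc)
  qed
  have m': "(dec_m K p ?v k j - m k j)\<^sup>2 \<le> 2 * (m_hat n p Rx z k j - m k j)\<^sup>2 + 2 * s\<^sup>2 * (\<zeta> (K + (k - 1) * p + j))\<^sup>2"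
    if k: "k \<in> {1..K}" and j: "j < p" for k j
  proof -
    have "K + (k - 1) * p + j < K * (p + 1)" using k j by (rule m_index_less)
    then have "theta_hat n K p Rx z (K + (k - 1) * p + j) = m_hat n p Rx z k j"
      using k j by (simp add: theta_hat_def)
    then have "dec_m K p ?v k j - m k j = (m_hat n p Rx z k j - m k j) + s * \<zeta> (K + (k - 1) * p + j)"
      by (simp add: dec_m_def)
    then show ?thesis using square_sum_le[of "m_hat n p Rx z k j - m k j" "s * \<zeta> (K + (k - 1) * p + j)"]
      by (simp only: power_mult_distrib mult.assoc)
  qed
  have "(\<Sum>k=1..K. (mu_tilde K c0 ?v k - mu k)\<^sup>2)
    \<le> (\<Sum>k=1..K. 4 * real K / c0\<^sup>2 * (\<Sum>j=1..K. (dec_mu K ?v j - mu j)\<^sup>2))"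
    by (intro sum_mono mu_tilde_error c0 mu_gt mu_sum)
  also have "\<dots> = 4 * (real K)\<^sup>2 / c0\<^sup>2 * (\<Sum>j=1..K. (dec_mu K ?v j - mu j)\<^sup>2)"
    by (simp only: sum_constant card_atLeastAtMost) (simp add: power2_eq_square)
  also have "\<dots> \<le> 4 * (real K)\<^sup>2 / c0\<^sup>2 * (\<Sum>k=1..K. 2 * (mu_hat n z k - mu k)\<^sup>2 + 2 * s\<^sup>2 * (\<zeta> (k - 1))\<^sup>2)"
    by (intro mult_left_mono sum_mono mu') auto
  finally have 1: "(\<Sum>k=1..K. (mu_tilde K c0 ?v k - mu k)\<^sup>2)
    \<le> 4 * (real K)\<^sup>2 / c0\<^sup>2 * (\<Sum>k=1..K. 2 * (mu_hat n z k - mu k)\<^sup>2 + 2 * s\<^sup>2 * (\<zeta> (k - 1))\<^sup>2)" .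
  have 2: "(\<Sum>k=1..K. \<Sum>j<p. (dec_m K p ?v k j - m k j)\<^sup>2)
    \<le> (\<Sum>k=1..K. \<Sum>j<p. 2 * (m_hat n p Rx z k j - m k j)\<^sup>2 + 2 * s\<^sup>2 * (\<zeta> (K + (k - 1) * p + j))\<^sup>2)"
    by (intro sum_mono m') auto
  have "est_loss K p c0 mu m ?v = (\<Sum>k=1..K. (mu_tilde K c0 ?v k - mu k)\<^sup>2)
      + (\<Sum>k=1..K. \<Sum>j<p. (dec_m K p ?v k j - m k j)\<^sup>2)"
    by (simp add: est_loss_def sum.distrib vnorm_square)
  also note add_mono[OF 1 2]
  finally show ?thesis
    by (simp only: hat_loss_def sum.distrib flip: sum_distrib_left) (simp only: distrib_left ac_simps)
qed

end

subsection \<open>Risk bound\<close>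

text \<open>Measurability, nonnegativity and the bound are bundled so that the mean of a large
  expression can be bounded by introduction rules following its structure. Nonnegativity is included
  because \<open>ennreal\<close> truncates, and so is additive and multiplicative only on
  nonnegative reals.\<close>

definition mean_le :: "'a measure \<Rightarrow> ('a \<Rightarrow> real) \<Rightarrow> real \<Rightarrow> bool" where
  "mean_le M f b \<longleftrightarrow> f \<in> borel_measurable M \<and> (\<forall>x. 0 \<le> f x) \<and> 0 \<le> b \<and> (\<integral>\<^sup>+x. ennreal (f x) \<partial>M) \<le> ennreal b"

lemma mean_le_const: "prob_space M \<Longrightarrow> 0 \<le> a \<Longrightarrow> mean_le M (\<lambda>_. a) a"
  by (simp add: mean_le_def prob_space.emeasure_space_1)

lemma mean_le_add:
  assumes "mean_le M f a" "mean_le M g b"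
  shows "mean_le M (\<lambda>x. f x + g x) (a + b)"
proof -
  have "(\<integral>\<^sup>+x. ennreal (f x + g x) \<partial>M) = (\<integral>\<^sup>+x. ennreal (f x) + ennreal (g x) \<partial>M)"
    using assms by (simp add: mean_le_def)
  also have "\<dots> = (\<integral>\<^sup>+x. ennreal (f x) \<partial>M) + (\<integral>\<^sup>+x. ennreal (g x) \<partial>M)"
    using assms by (intro nn_integral_add) (auto simp: mean_le_def)
  also have "\<dots> \<le> ennreal a + ennreal b"
    using assms by (intro add_mono) (auto simp: mean_le_def)
  finally show ?thesis using assms by (auto simp: mean_le_def intro!: borel_measurable_add)
qed

lemma mean_le_cmult:
  assumes "mean_le M f a" "0 \<le> c"
  shows "mean_le M (\<lambda>x. c * f x) (c * a)"
proof -
  have "(\<integral>\<^sup>+x. ennreal (c * f x) \<partial>M) = (\<integral>\<^sup>+x. ennreal c * ennreal (f x) \<partial>M)"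
    using assms by (simp add: mean_le_def ennreal_mult)
  also have "\<dots> = ennreal c * (\<integral>\<^sup>+x. ennreal (f x) \<partial>M)"
    using assms by (intro nn_integral_cmult) (auto simp: mean_le_def)
  also have "\<dots> \<le> ennreal c * ennreal a"
    using assms by (intro mult_left_mono) (auto simp: mean_le_def)
  finally show ?thesis using assms
    by (auto simp: mean_le_def ennreal_mult intro!: borel_measurable_times)
qed

lemma mean_le_sum:
  assumes "finite T" "\<And>t. t \<in> T \<Longrightarrow> mean_le M (f t) (b t)"
  shows "mean_le M (\<lambda>x. \<Sum>t\<in>T. f t x) (\<Sum>t\<in>T. b t)"
  using assms
proof (induction T rule: finite_induct)
  case empty
  show ?case by (simp add: mean_le_def)
next
  case (insert t T)
  then show ?case using mean_le_add[of M "f t" "b t"] by simp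
qed

section \<open>Averaging over the noise and over the data\<close>

context eptr_setting
begin

lemma prob_space_sample: "prob_space (sample_dist K p mu m)"
  using mu_nonneg mu_sum p by (rule prob_space_sample_dist)

lemma prob_space_data: "prob_space (data_dist n K p mu m)"
  unfolding data_dist_def using prob_space_sample by (intro prob_space_PiM)

lemma measurable_data_coord:
  assumes "i < n" "j < p" "h \<in> borel_measurable borel"
  shows "(\<lambda>z. of_bool (fst (z i) = k) * h (snd (z i) j) :: real) \<in> borel_measurable (data_dist n K p mu m)"
proof -
  have "(\<lambda>z. z i) \<in> measurable (data_dist n K p mu m) (sample_dist K p mu m)"
    unfolding data_dist_def using assms(1) by (intro measurable_component_singleton) simp
  from measurable_compose[OF this measurable_sample_dist_class[OF assms(2,3), of k K mu m]]
  show ?thesis .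
qed

lemma mean_mu_hat:
  assumes k: "k \<in> {1..K}"
  shows "mean_le (data_dist n K p mu m) (\<lambda>z. (mu_hat n z k - mu k)\<^sup>2) (1 / n)"
proof -
  have [measurable]: "(\<lambda>z. of_bool (fst (z i) = k) :: real) \<in> borel_measurable (data_dist n K p mu m)" if "i < n" for i
    using measurable_data_coord[OF that, of 0 "\<lambda>_. 1" k] p by simp
  have "mean_le (data_dist n K p mu m) (\<lambda>z. (\<Sum>i<n. of_bool (fst (z i) = k) - mu k)\<^sup>2) n"
    using nn_integral_class_freq[OF mu_nonneg mu_sum p k, of n m] by (auto simp: mean_le_def)
  then have "mean_le (data_dist n K p mu m) (\<lambda>z. 1 / n\<^sup>2 * (\<Sum>i<n. of_bool (fst (z i) = k) - mu k)\<^sup>2) (1 / n\<^sup>2 * n)"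
    by (rule mean_le_cmult) simp
  moreover have "1 / n\<^sup>2 * (\<Sum>i<n. of_bool (fst (z i) = k) - mu k)\<^sup>2 = (mu_hat n z k - mu k)\<^sup>2" for z
  proof -
    have "mu_hat n z k - mu k = (\<Sum>i<n. of_bool (fst (z i) = k) - mu k) / n"
      using n by (simp add: mu_hat_def card_class_idx sum_subtractf field_simps)
    then show ?thesis by (simp add: power_divide)
  qed
  moreover have "1 / n\<^sup>2 * n = 1 / real n" by (simp add: power2_eq_square)
  ultimately show ?thesis by simp
qed

lemma mean_class_exp:
  assumes "k \<in> {1..K}" "j < p" "i < n"
  shows "mean_le (data_dist n K p mu m)
    (\<lambda>z. of_bool (fst (z i) = k) * exp ((snd (z i) j - m k j)\<^sup>2 / 4)) 2"
  using nn_integral_class_exp[OF mu_nonneg mu_sum assms(2,1,3)]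
    measurable_data_coord[OF assms(3,2), of "\<lambda>y. exp ((y - m k j)\<^sup>2 / 4)"]
  by (auto simp: mean_le_def)

lemma mean_class_sum:
  assumes "k \<in> {1..K}" "j < p"
  shows "mean_le (data_dist n K p mu m)
    (\<lambda>z. (\<Sum>i<n. of_bool (fst (z i) = k) * (snd (z i) j - m k j))\<^sup>2) n"
proof -
  have meas: "(\<lambda>z. of_bool (fst (z i) = k) * (snd (z i) j - m k j)) \<in> borel_measurable (data_dist n K p mu m)"
    if "i < n" for i
    using measurable_data_coord[OF that assms(2), of "\<lambda>y. y - m k j"] by simp
  show ?thesis
    unfolding mean_le_def
    by (intro conjI allI zero_le_power2 of_nat_0_le_iff nn_integral_class_sum mu_nonneg mu_sum assms
        borel_measurable_power borel_measurable_sum meas) auto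
qed

text \<open>Each coordinate has mean square 1. The bound is left as unevaluated sums, in the shape
  the introduction rules produce; its value is \<open>noise_dim\<close>.\<close>

lemma mean_noise:
  "mean_le (std_gauss (K * (p + 1)))
    (\<lambda>\<zeta>. 4 * (real K)\<^sup>2 / c0\<^sup>2 * (\<Sum>k=1..K. (\<zeta> (k - 1))\<^sup>2) + (\<Sum>k=1..K. \<Sum>j<p. (\<zeta> (K + (k - 1) * p + j))\<^sup>2))
    (4 * (real K)\<^sup>2 / c0\<^sup>2 * (\<Sum>k=1..K. 1) + (\<Sum>k=1..K. \<Sum>j<p. 1))"
proof -
  have coord: "mean_le (std_gauss q) (\<lambda>\<zeta>. (\<zeta> i)\<^sup>2) 1" if "i < q" for i q
  proof -
    have [measurable]: "(\<lambda>\<zeta>. \<zeta> i) \<in> borel_measurable (std_gauss q)"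
      unfolding std_gauss_def using measurable_component_singleton[of i "{..<q}" "\<lambda>_. density lborel std_normal_density"] that
      by simp
    show ?thesis using nn_integral_std_gauss_square[OF that] by (simp add: mean_le_def)
  qed
  have idx0: "k - 1 < K * (p + 1)" if "k \<in> {1..K}" for k
  proof -
    have "k - 1 < K" using that by auto
    also have "K \<le> K * (p + 1)" by simp
    finally show ?thesis .
  qed
  show ?thesis
    by (intro mean_le_add mean_le_cmult mean_le_sum coord m_index_less idx0) auto
qed

definition noise_dim :: real where "noise_dim = 4 * (real K)\<^sup>2 / c0\<^sup>2 * real K + real K * p"

lemma hat_loss_nonneg: "hat_loss z \<ge> 0"
  unfolding hat_loss_def
  by (intro add_nonneg_nonneg mult_nonneg_nonneg divide_nonneg_nonneg sum_nonneg) simp_all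

text \<open>For fixed data \<open>hat_loss z\<close> is a constant, and only the noise is
  averaged.\<close>

lemma expected_noisy_loss:
  "(\<integral>\<^sup>+\<zeta>. ennreal (est_loss K p c0 mu m (\<lambda>i. theta_hat n K p Rx z i + s * \<zeta> i)) \<partial>std_gauss (K * (p + 1)))
    \<le> ennreal (2 * hat_loss z + 2 * s\<^sup>2 * noise_dim)"
proof -
  let ?G = "std_gauss (K * (p + 1))"
  have ps: "prob_space ?G"
    unfolding std_gauss_def by (intro prob_space_PiM prob_space_normal_density) auto
  have h: "0 \<le> 2 * hat_loss z" using hat_loss_nonneg by simp
  have "mean_le ?G (\<lambda>\<zeta>. 2 * hat_loss z + 2 * s\<^sup>2 * (4 * (real K)\<^sup>2 / c0\<^sup>2 * (\<Sum>k=1..K. (\<zeta> (k - 1))\<^sup>2)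
        + (\<Sum>k=1..K. \<Sum>j<p. (\<zeta> (K + (k - 1) * p + j))\<^sup>2)))
    (2 * hat_loss z + 2 * s\<^sup>2 * (4 * (real K)\<^sup>2 / c0\<^sup>2 * (\<Sum>k=1..K. 1) + (\<Sum>k=1..K. \<Sum>j<p. 1)))"
    by (intro mean_le_add[OF mean_le_const[OF ps h]] mean_le_cmult mean_noise) auto
  then have "(\<integral>\<^sup>+\<zeta>. ennreal (2 * hat_loss z + 2 * s\<^sup>2 * (4 * (real K)\<^sup>2 / c0\<^sup>2 * (\<Sum>k=1..K. (\<zeta> (k - 1))\<^sup>2)
        + (\<Sum>k=1..K. \<Sum>j<p. (\<zeta> (K + (k - 1) * p + j))\<^sup>2))) \<partial>?G) \<le> ennreal (2 * hat_loss z + 2 * s\<^sup>2 * noise_dim)"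
    by (simp add: mean_le_def noise_dim_def)
  then show ?thesis
    by (rule order_trans[rotated]) (intro nn_integral_mono ennreal_leI est_loss_noisy)
qed

text \<open>A majorant of the integrand from which the reply probability has been eliminated; each
  random term left has a known mean bound. The first coefficient adds the frequency errors from a
  reply and those that bound the no-reply probability.\<close>

definition pointwise_bound :: "real \<Rightarrow> (nat \<Rightarrow> nat \<times> (nat \<Rightarrow> real)) \<Rightarrow> real" where
  "pointwise_bound s z =
    (8 * (real K)\<^sup>2 / c0\<^sup>2 + real K * ((1 + Cm\<^sup>2) * p) * (4 / c0\<^sup>2)) * (\<Sum>k=1..K. (mu_hat n z k - mu k)\<^sup>2)
    + 2 * (\<Sum>k=1..K. 34 * Cm\<^sup>2 * (p / n)
      + (4 * Cm\<^sup>2 + 32) / (c0 * n\<^sup>2) * (\<Sum>i<n. \<Sum>j<p. of_bool (fst (z i) = k) * exp ((snd (z i) j - m k j)\<^sup>2 / 4))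
      + 2 / (c0\<^sup>2 * n\<^sup>2) * (\<Sum>j<p. (\<Sum>i<n. of_bool (fst (z i) = k) * (snd (z i) j - m k j))\<^sup>2))
    + (2 * s\<^sup>2 * noise_dim + real K * ((1 + Cm\<^sup>2) * p) * (1 / n))"

lemma noise_dim_nonneg: "noise_dim \<ge> 0"
  by (simp add: noise_dim_def)

text \<open>The reply probability is kept on the errors of the class means, which may be large in
  small classes, and bounded by 1 on the frequency errors and the noise.\<close>

lemma loss_le_pointwise_bound:
  fixes s z
  defines "P \<equiv> ePTR_prob \<epsilon> \<delta> (gamma_fn n K c0 z)"
  shows "P * (2 * hat_loss z + 2 * s\<^sup>2 * noise_dim) + (1 - P) * est_loss K p c0 mu m (\<lambda>_. 0) \<le> pointwise_bound s z"
proof -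
  have P: "0 \<le> P" "P \<le> 1" unfolding P_def by (rule ePTR_prob_bounds)+
  define A where "A = (\<Sum>k=1..K. (mu_hat n z k - mu k)\<^sup>2)"
  define B where "B = (\<Sum>k=1..K. 34 * Cm\<^sup>2 * (p / n)
      + (4 * Cm\<^sup>2 + 32) / (c0 * n\<^sup>2) * (\<Sum>i<n. \<Sum>j<p. of_bool (fst (z i) = k) * exp ((snd (z i) j - m k j)\<^sup>2 / 4))
      + 2 / (c0\<^sup>2 * n\<^sup>2) * (\<Sum>j<p. (\<Sum>i<n. of_bool (fst (z i) = k) * (snd (z i) j - m k j))\<^sup>2))"
  have A0: "A \<ge> 0" by (simp add: A_def sum_nonneg)
  have "P * (\<Sum>k=1..K. \<Sum>j<p. (m_hat n p Rx z k j - m k j)\<^sup>2)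
    = (\<Sum>k=1..K. P * (\<Sum>j<p. (m_hat n p Rx z k j - m k j)\<^sup>2))" by (rule sum_distrib_left)
  also have "\<dots> \<le> B" unfolding B_def P_def by (intro sum_mono reply_m_hat_error)
  finally have 1: "P * (\<Sum>k=1..K. \<Sum>j<p. (m_hat n p Rx z k j - m k j)\<^sup>2) \<le> B" .
  have 2: "P * (4 * (real K)\<^sup>2 / c0\<^sup>2 * A) \<le> 4 * (real K)\<^sup>2 / c0\<^sup>2 * A"
    using P A0 by (intro mult_left_le_one_le) auto
  have 3: "P * (2 * s\<^sup>2 * noise_dim) \<le> 2 * s\<^sup>2 * noise_dim"
    using P noise_dim_nonneg by (intro mult_left_le_one_le) auto
  have "(1 - P) * est_loss K p c0 mu m (\<lambda>_. 0) \<le> (1 - P) * (real K * ((1 + Cm\<^sup>2) * p))"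
    using P by (intro mult_left_mono est_loss_zero) auto
  also have "\<dots> \<le> (1 / n + 4 / c0\<^sup>2 * A) * (real K * ((1 + Cm\<^sup>2) * p))"
    unfolding A_def P_def by (intro mult_right_mono no_reply_prob) auto
  finally have 4: "(1 - P) * est_loss K p c0 mu m (\<lambda>_. 0) \<le> (1 / n + 4 / c0\<^sup>2 * A) * (real K * ((1 + Cm\<^sup>2) * p))" .
  have "P * (2 * hat_loss z + 2 * s\<^sup>2 * noise_dim) = 2 * (P * (4 * (real K)\<^sup>2 / c0\<^sup>2 * A))
      + 2 * (P * (\<Sum>k=1..K. \<Sum>j<p. (m_hat n p Rx z k j - m k j)\<^sup>2)) + P * (2 * s\<^sup>2 * noise_dim)"
    unfolding hat_loss_def A_def[symmetric] by (simp only: distrib_left mult.left_commute mult.assoc)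
  moreover have "pointwise_bound s z = 2 * (4 * (real K)\<^sup>2 / c0\<^sup>2 * A) + 2 * B + 2 * s\<^sup>2 * noise_dim
      + (1 / n + 4 / c0\<^sup>2 * A) * (real K * ((1 + Cm\<^sup>2) * p))"
    unfolding pointwise_bound_def A_def[symmetric] B_def[symmetric] by (simp add: algebra_simps)
  ultimately show ?thesis using 1 2 3 4 by linarith
qed

definition data_const :: real where
  "data_const = 8 * real K ^ 3 / c0\<^sup>2 + real K * (1 + Cm\<^sup>2) * (4 * real K / c0\<^sup>2) + 2 * real K * (34 * Cm\<^sup>2 + (8 * Cm\<^sup>2 + 64) / c0 + 2 / c0\<^sup>2)
    + real K * (1 + Cm\<^sup>2)"

lemma mean_pointwise_bound:
  "(\<integral>\<^sup>+z. ennreal (pointwise_bound s z) \<partial>data_dist n K p mu m) \<le> ennreal (data_const * (p / n) + 2 * s\<^sup>2 * noise_dim)"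
proof -
  \<comment> \<open>The pointwise bound with each random term replaced by its mean bound.\<close>
  let ?b = "(8 * (real K)\<^sup>2 / c0\<^sup>2 + real K * ((1 + Cm\<^sup>2) * p) * (4 / c0\<^sup>2)) * (\<Sum>k=1..K. 1 / n)
    + 2 * (\<Sum>k=1..K. 34 * Cm\<^sup>2 * (p / n)
      + (4 * Cm\<^sup>2 + 32) / (c0 * n\<^sup>2) * (\<Sum>i<n. \<Sum>j<p. 2)
      + 2 / (c0\<^sup>2 * n\<^sup>2) * (\<Sum>j<p. real n))
    + (2 * s\<^sup>2 * noise_dim + real K * ((1 + Cm\<^sup>2) * p) * (1 / n))"
  have "mean_le (data_dist n K p mu m) (pointwise_bound s) ?b"
    unfolding pointwise_bound_def
    by (intro mean_le_add mean_le_cmult mean_le_sum mean_le_const[OF prob_space_data]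
        mean_mu_hat mean_class_exp mean_class_sum)
      (use c0 noise_dim_nonneg in \<open>auto intro!: add_nonneg_nonneg mult_nonneg_nonneg divide_nonneg_nonneg\<close>)
  then have "(\<integral>\<^sup>+z. ennreal (pointwise_bound s z) \<partial>data_dist n K p mu m) \<le> ennreal ?b"
    by (simp add: mean_le_def)
  also have "\<dots> \<le> ennreal (data_const * (p / n) + 2 * s\<^sup>2 * noise_dim)"
  proof (rule ennreal_leI)
    have "(\<Sum>i<n. \<Sum>j<p. 2 :: real) = 2 * n * p" "(\<Sum>j<p. real n) = n * p" by simp_all
    then have "?b = 8 * real K ^ 3 / c0\<^sup>2 / n + (data_const - 8 * real K ^ 3 / c0\<^sup>2) * (p / n) + 2 * s\<^sup>2 * noise_dim"
      using n c0 by (simp add: data_const_def field_simps power2_eq_square power3_eq_cube)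
    \<comment> \<open>The frequency errors contribute without a factor \<open>p\<close>;
      \<open>p \<ge> 1\<close> inserts it.\<close>
    moreover have "8 * real K ^ 3 / c0\<^sup>2 / n \<le> 8 * real K ^ 3 / c0\<^sup>2 * (p / n)"
      using p n mult_left_mono[of 1 "real p" "8 * real K ^ 3 / c0\<^sup>2 / n"] by simp
    ultimately show "?b \<le> data_const * (p / n) + 2 * s\<^sup>2 * noise_dim" by (simp add: algebra_simps)
  qed
  finally show ?thesis .
qed

definition noise_const :: real where
  "noise_const = 128 * (4 * real K ^ 3 / c0\<^sup>2 + real K) * (32 * Cm\<^sup>2 / c0\<^sup>2 + 2)"

text \<open>The squared noise scale is of order \<open>Rx\<^sup>2 * ln (1 / \<delta>) /
  (\<epsilon>\<^sup>2 * n\<^sup>2)\<close>, and \<open>Rx\<^sup>2\<close> is of order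
  \<open>p * ln n\<close>; the second factor \<open>p\<close> is the number of noisy coordinates.
  Additive constants are absorbed by \<open>p * ln n \<ge> 1\<close> and
  \<open>ln (1 / \<delta>) \<ge> 1\<close>.\<close>

lemma noise_bound:
  "2 * (noise_scale (alpha_fn n Rx c0) \<epsilon> \<delta>)\<^sup>2 * noise_dim
    \<le> noise_const * (real p ^ 2 * ln n * ln (1 / \<delta>) / (\<epsilon>\<^sup>2 * real n ^ 2))"
proof -
  let ?L = "ln (1 / \<delta>)"
  have "ln (1.25 / \<delta>) = ln 1.25 + ?L" using delta ln_mult[of "1.25" "1 / \<delta>"] by simp
  moreover have "ln 1.25 \<le> (1::real)" using ln_le_minus_one[of "1.25::real"] by simp
  moreover have "0 \<le> ln (1.25::real)" by simp
  ultimately have l: "0 \<le> ln (1.25 / \<delta>)" "ln (1.25 / \<delta>) \<le> 2 * ?L" using ln_delta by linarith+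
  have a: "(alpha_fn n Rx c0)\<^sup>2 = 4 / n\<^sup>2 * (2 * Rx\<^sup>2 / c0\<^sup>2 + 2)"
    by (simp add: alpha_fn_def power_mult_distrib power_divide)
  have pl: "1 \<le> p * ln n" using p ln_n mult_mono[of 1 "real p" 1 "ln n"] by simp
  have a2: "2 * Rx\<^sup>2 / c0\<^sup>2 + 2 \<le> (32 * Cm\<^sup>2 / c0\<^sup>2 + 2) * (p * ln n)"
    using pl by (simp add: Rx_square distrib_right)
  have "(noise_scale (alpha_fn n Rx c0) \<epsilon> \<delta>)\<^sup>2
    = 4 / \<epsilon>\<^sup>2 * (4 / n\<^sup>2 * (2 * Rx\<^sup>2 / c0\<^sup>2 + 2)) * (2 * ln (1.25 / \<delta>))"
    using l by (simp add: noise_scale_def power_mult_distrib power_divide a)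
  also have "\<dots> \<le> 4 / \<epsilon>\<^sup>2 * (4 / n\<^sup>2 * ((32 * Cm\<^sup>2 / c0\<^sup>2 + 2) * (p * ln n))) * (2 * (2 * ?L))"
    using l a2 pl by (intro mult_mono) (auto intro!: mult_nonneg_nonneg add_nonneg_nonneg)
  finally have s: "(noise_scale (alpha_fn n Rx c0) \<epsilon> \<delta>)\<^sup>2
    \<le> 4 / \<epsilon>\<^sup>2 * (4 / n\<^sup>2 * ((32 * Cm\<^sup>2 / c0\<^sup>2 + 2) * (p * ln n))) * (2 * (2 * ?L))" .
  have "4 * real K ^ 3 / c0\<^sup>2 * 1 \<le> 4 * real K ^ 3 / c0\<^sup>2 * p" using p by (intro mult_left_mono) auto
  then have d: "noise_dim \<le> (4 * real K ^ 3 / c0\<^sup>2 + real K) * p"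
    by (simp add: noise_dim_def algebra_simps power2_eq_square power3_eq_cube)
  have "2 * (noise_scale (alpha_fn n Rx c0) \<epsilon> \<delta>)\<^sup>2 * noise_dim
    \<le> 2 * (4 / \<epsilon>\<^sup>2 * (4 / n\<^sup>2 * ((32 * Cm\<^sup>2 / c0\<^sup>2 + 2) * (p * ln n))) * (2 * (2 * ?L))) * ((4 * real K ^ 3 / c0\<^sup>2 + real K) * p)"
    \<comment> \<open>Monotonicity of the product needs the upper bound for the squared scale to be
      nonnegative, which follows as it dominates a square.\<close>
    using order_trans[OF zero_le_power2 s]
    by (intro mult_mono mult_left_mono s d noise_dim_nonneg mult_nonneg_nonneg[of 2]) auto
  also have "\<dots> = noise_const * (real p ^ 2 * ln n * ?L / (\<epsilon>\<^sup>2 * real n ^ 2))"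
    by (simp add: noise_const_def power2_eq_square[of "real p"])
  finally show ?thesis .
qed

lemma expected_loss_le:
  "expected_loss n K p c0 Rx \<epsilon> \<delta> mu m
    \<le> ennreal (data_const * (p / n) + noise_const * (real p ^ 2 * ln n * ln (1 / \<delta>) / (\<epsilon>\<^sup>2 * real n ^ 2)))"
proof -
  let ?s = "noise_scale (alpha_fn n Rx c0) \<epsilon> \<delta>"
  let ?P = "\<lambda>z. ePTR_prob \<epsilon> \<delta> (gamma_fn n K c0 z)"
  have "expected_loss n K p c0 Rx \<epsilon> \<delta> mu m \<le> (\<integral>\<^sup>+z. ennreal (pointwise_bound ?s z) \<partial>data_dist n K p mu m)"
    unfolding expected_loss_def Let_def
  proof (rule nn_integral_mono)
    fix z
    have h: "0 \<le> 2 * hat_loss z + 2 * ?s\<^sup>2 * noise_dim"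
      using noise_dim_nonneg hat_loss_nonneg by simp
    have e: "0 \<le> est_loss K p c0 mu m (\<lambda>_. 0)" by (simp add: est_loss_def sum_nonneg)
    have "ennreal (?P z) * (\<integral>\<^sup>+ \<zeta>. ennreal (est_loss K p c0 mu m (\<lambda>i. theta_hat n K p Rx z i + ?s * \<zeta> i)) \<partial>std_gauss (K * (p + 1)))
        + ennreal (1 - ?P z) * ennreal (est_loss K p c0 mu m (\<lambda>_. 0))
      \<le> ennreal (?P z) * ennreal (2 * hat_loss z + 2 * ?s\<^sup>2 * noise_dim)
        + ennreal (1 - ?P z) * ennreal (est_loss K p c0 mu m (\<lambda>_. 0))"
      by (intro add_right_mono mult_left_mono expected_noisy_loss) auto
    also have "\<dots> = ennreal (?P z * (2 * hat_loss z + 2 * ?s\<^sup>2 * noise_dim) + (1 - ?P z) * est_loss K p c0 mu m (\<lambda>_. 0))"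
      using ePTR_prob_bounds h e by (simp add: ennreal_mult ennreal_plus mult_nonneg_nonneg)
    also have "\<dots> \<le> ennreal (pointwise_bound ?s z)"
      by (intro ennreal_leI loss_le_pointwise_bound)
    finally show "ennreal (?P z) * (\<integral>\<^sup>+ \<zeta>. ennreal (est_loss K p c0 mu m (\<lambda>i. theta_hat n K p Rx z i + ?s * \<zeta> i)) \<partial>std_gauss (K * (p + 1)))
        + ennreal (1 - ?P z) * ennreal (est_loss K p c0 mu m (\<lambda>_. 0)) \<le> ennreal (pointwise_bound ?s z)" .
  qed
  also have "\<dots> \<le> ennreal (data_const * (p / n) + 2 * ?s\<^sup>2 * noise_dim)"
    by (rule mean_pointwise_bound)
  also have "\<dots> \<le> ennreal (data_const * (p / n) + noise_const * (real p ^ 2 * ln n * ln (1 / \<delta>) / (\<epsilon>\<^sup>2 * real n ^ 2)))"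
    by (intro ennreal_leI add_left_mono noise_bound)
  finally show ?thesis .
qed

end

section \<open>Uniformity of the constant\<close>

theorem theorem4:
  fixes K :: nat and c0 Cm :: real
  assumes "c0 > 0" and "Cm \<ge> 2"
  shows "\<exists>C::real. \<forall>(n::nat) (p::nat) (mu::nat \<Rightarrow> real) (m::nat \<Rightarrow> nat \<Rightarrow> real) (\<epsilon>::real) (\<delta>::real).
    (\<forall>k\<in>{1..K}. mu k \<ge> 0) \<and> (\<Sum>k\<in>{1..K}. mu k) = 1 \<and>
    (\<forall>k\<in>{1..K}. mu k > 2 * c0) \<and>
    (\<forall>k\<in>{1..K}. vnorm p (m k) \<le> Cm * sqrt (real p)) \<and>
    0 < \<epsilon> \<and> \<epsilon> < 2 \<and> 0 < \<delta> \<and> \<delta> < 1 / real n ^ 3 \<and>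
    n \<ge> 3 \<and> p \<ge> 1 \<and>
    real n \<ge> 4 / c0 + 8 / (c0 * \<epsilon>) * ln (1 / \<delta>)
    \<longrightarrow> expected_loss n K p c0 (4 * Cm * sqrt (real p * ln (real n))) \<epsilon> \<delta> mu m
        \<le> ennreal (C * (real p / real n
              + real p ^ 2 * ln (real n) * ln (1 / \<delta>) / (\<epsilon>^2 * real n ^ 2)))"
proof (intro exI allI impI, elim conjE)
  \<comment> \<open>The witness is the sum of \<open>data_const\<close> and
    \<open>noise_const\<close>, spelled out before the other parameters are fixed: this makes
    visible that it depends only on \<open>K\<close>, \<open>c0\<close> and
    \<open>Cm\<close>.\<close>
  let ?A = "8 * real K ^ 3 / c0\<^sup>2 + real K * (1 + Cm\<^sup>2) * (4 * real K / c0\<^sup>2) + 2 * real K * (34 * Cm\<^sup>2 + (8 * Cm\<^sup>2 + 64) / c0 + 2 / c0\<^sup>2)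
    + real K * (1 + Cm\<^sup>2)"
  let ?B = "128 * (4 * real K ^ 3 / c0\<^sup>2 + real K) * (32 * Cm\<^sup>2 / c0\<^sup>2 + 2)"
  fix n p :: nat and mu :: "nat \<Rightarrow> real" and m :: "nat \<Rightarrow> nat \<Rightarrow> real" and \<epsilon> \<delta> :: real
  assume *: "\<forall>k\<in>{1..K}. mu k \<ge> 0" "(\<Sum>k\<in>{1..K}. mu k) = 1"
    "\<forall>k\<in>{1..K}. mu k > 2 * c0" "\<forall>k\<in>{1..K}. vnorm p (m k) \<le> Cm * sqrt (real p)"
    "0 < \<epsilon>" "\<epsilon> < 2" "0 < \<delta>" "\<delta> < 1 / real n ^ 3" "n \<ge> 3" "p \<ge> 1"
    "real n \<ge> 4 / c0 + 8 / (c0 * \<epsilon>) * ln (1 / \<delta>)"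
  interpret eptr_setting K n p c0 Cm \<epsilon> \<delta> mu m
    using * assms by unfold_locales auto
  let ?x = "real p / real n" and ?y = "real p ^ 2 * ln (real n) * ln (1 / \<delta>) / (\<epsilon>^2 * real n ^ 2)"
  have A: "0 \<le> ?A" using assms by (intro add_nonneg_nonneg mult_nonneg_nonneg divide_nonneg_nonneg) auto
  have B: "0 \<le> ?B" by (intro add_nonneg_nonneg mult_nonneg_nonneg divide_nonneg_nonneg) auto
  have y: "0 \<le> ?y" using ln_n ln_delta by (intro mult_nonneg_nonneg divide_nonneg_nonneg) auto
  have "a * x + b * y \<le> (a + b) * (x + y)" if "0 \<le> a" "0 \<le> b" "0 \<le> x" "0 \<le> y" for a b x y :: real
    using mult_nonneg_nonneg[OF that(1,4)] mult_nonneg_nonneg[OF that(2,3)] by (simp add: algebra_simps)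
  from this[OF A B _ y, of ?x]
  have "ennreal (?A * ?x + ?B * ?y) \<le> ennreal ((?A + ?B) * (?x + ?y))" by (intro ennreal_leI) simp
  then show "expected_loss n K p c0 (4 * Cm * sqrt (real p * ln (real n))) \<epsilon> \<delta> mu m
        \<le> ennreal ((?A + ?B) * (?x + ?y))"
    using expected_loss_le unfolding Rx_def data_const_def noise_const_def by (rule order_trans[rotated])
qed

end
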